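(* Let $g \in L^2(\mathbb{R})$ with $\|g\|_2 = 1$, and let $\Lambda = \{(a_k,b_k)\}_{k=1}^N \subset \mathbb{R}^2$ be a set of $N$ distinct points with $(a_1,b_1) = (0,0)$. Let $G_N = (\langle M_{b_k}T_{a_k} g, M_{b_\ell}T_{a_\ell} g\rangle)_{k,\ell=1}^N$ be the Gramian of $\{M_{b_k}T_{a_k}g\}_{k=1}^N$ and assume $G_N$ is positive definite. For $(a,b)\in\mathbb{R}^2$ let $u(a,b)\in\mathbb{C}^N$ have entries $u(a,b)_k = e^{-2\pi i a_k (b-b_k)} V_g g(a-a_k, b-b_k)$, $k=1,\dots,N$, let $G_{N+1}(a,b)$ be the Gramian of $\{M_{b_k}T_{a_k}g\}_{k=1}^N \cup \{M_bT_a g\}$, i.e. $G_{N+1}(a,b) = \begin{bmatrix} G_N & u(a,b) \\ u(a,b)^* & 1\end{bmatrix}$, and define $F:\mathbb{R}^2\to\mathbb{R}$ by $F(a,b) = \langle G_N^{-1} u(a,b), u(a,b)\rangle$. Then: (i) $0 \le F(a,b) \le 1$ for all $(a,b)\in\mathbb{R}^2$, and $F(a_k,b_k) = 1$ for each $k = 1,\dots,N$; (ii) $F$ is uniformly continuous and $\lim_{|(a,b)|\to\infty} F(a,b) = 0$; (iii) $\iint_{\mathbb{R}^2} F(a,b)\,da\,db = N$; (iv) the Fourier transform $\widehat{F}(\xi,\eta) = \iint_{\mathbb{R}^2} F(a,b) e^{-2\pi i (a\xi + b\eta)}\,da\,db$ is strictly positive definite and integrable on $\mathbb{R}^2$; (v)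 $\det G_{N+1}(a,b) = (1 - F(a,b))\det G_N$ for all $(a,b)\in\mathbb{R}^2$.
   Context: $M_b f(x) = e^{2\pi i b x} f(x)$ and $T_a f(x) = f(x-a)$. The short-time Fourier transform is $V_g f(x,y) = \int_{\mathbb{R}} f(t)\overline{g(t-x)} e^{-2\pi i y t}\,dt$. Inner products are linear in the first argument: $\langle f, h\rangle = \int f\overline{h}$ on $L^2(\mathbb{R})$ and $\langle v,w\rangle = \sum_j v_j\overline{w_j}$ on $\mathbb{C}^N$. A continuous function $\phi:\mathbb{R}^2\to\mathbb{C}$ is strictly positive definite if $\sum_{j,k=1}^M c_j\overline{c_k}\phi(x_j-x_k) \ge 0$ for all pairwise distinct $x_1,\dots,x_M\in\mathbb{R}^2$ and all $(c_k)\in\mathbb{C}^M$, with equality only when all $c_k = 0$. *)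

theory Defs
  imports "HOL-Analysis.Analysis" "Jordan_Normal_Form.Gauss_Jordan_Elimination" "Jordan_Normal_Form.Determinant"
begin

definition tf_shift :: "real \<Rightarrow> real \<Rightarrow> (real \<Rightarrow> complex) \<Rightarrow> real \<Rightarrow> complex" where
  "tf_shift a b g t = exp (2 * pi * \<i> * complex_of_real (b * t)) * g (t - a)"

definition L2_inner :: "(real \<Rightarrow> complex) \<Rightarrow> (real \<Rightarrow> complex) \<Rightarrow> complex" where
  "L2_inner f h = (LINT t|lborel. f t * cnj (h t))"

definition stft :: "(real \<Rightarrow> complex) \<Rightarrow> (real \<Rightarrow> complex) \<Rightarrow> real \<times> real \<Rightarrow> complex" where
  "stft g f p = (LINT t|lborel. f t * cnj (g (t - fst p)) * exp (- 2 * pi * \<i> * complex_of_real (snd p * t)))"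

definition gramian :: "(nat \<Rightarrow> real \<Rightarrow> complex) \<Rightarrow> nat \<Rightarrow> complex mat" where
  "gramian \<phi> n = mat n n (\<lambda>(k, l). L2_inner (\<phi> k) (\<phi> l))"

definition pos_def_mat :: "complex mat \<Rightarrow> nat \<Rightarrow> bool" where
  "pos_def_mat G n \<longleftrightarrow> G \<in> carrier_mat n n \<and>
     (\<forall>i<n. \<forall>j<n. G $$ (i, j) = cnj (G $$ (j, i))) \<and>
     (\<forall>v \<in> carrier_vec n. v \<noteq> 0\<^sub>v n \<longrightarrow> Im ((G *\<^sub>v v) \<bullet>c v) = 0 \<and> Re ((G *\<^sub>v v) \<bullet>c v) > 0)"

text \<open>Points are indexed 0..N-1 (point 0 corresponds to (a_1,b_1) of the paper).\<close>
definition sys :: "(real \<Rightarrow> complex) \<Rightarrow> (nat \<Rightarrow> real) \<Rightarrow> (nat \<Rightarrow> real) \<Rightarrow> nat \<Rightarrow> real \<Rightarrow> complex" where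
  "sys g a b k = tf_shift (a k) (b k) g"

definition GN :: "(real \<Rightarrow> complex) \<Rightarrow> (nat \<Rightarrow> real) \<Rightarrow> (nat \<Rightarrow> real) \<Rightarrow> nat \<Rightarrow> complex mat" where
  "GN g a b N = gramian (sys g a b) N"

definition GN1 :: "(real \<Rightarrow> complex) \<Rightarrow> (nat \<Rightarrow> real) \<Rightarrow> (nat \<Rightarrow> real) \<Rightarrow> nat \<Rightarrow> real \<times> real \<Rightarrow> complex mat" where
  "GN1 g a b N p = gramian ((sys g a b)(N := tf_shift (fst p) (snd p) g)) (Suc N)"

definition uvec :: "(real \<Rightarrow> complex) \<Rightarrow> (nat \<Rightarrow> real) \<Rightarrow> (nat \<Rightarrow> real) \<Rightarrow> nat \<Rightarrow> real \<times> real \<Rightarrow> complex vec" where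
  "uvec g a b N p = vec N (\<lambda>k. exp (- 2 * pi * \<i> * complex_of_real (a k * (snd p - b k)))
                                 * stft g g (fst p - a k, snd p - b k))"

text \<open>The (complex) value < G_N^{-1} u(a,b), u(a,b) >; the paper's F is its real part (it is real).\<close>
definition Fc :: "(real \<Rightarrow> complex) \<Rightarrow> (nat \<Rightarrow> real) \<Rightarrow> (nat \<Rightarrow> real) \<Rightarrow> nat \<Rightarrow> real \<times> real \<Rightarrow> complex" where
  "Fc g a b N p = (the (mat_inverse (GN g a b N)) *\<^sub>v uvec g a b N p) \<bullet>c uvec g a b N p"

definition fourier2 :: "(real \<times> real \<Rightarrow> complex) \<Rightarrow> real \<times> real \<Rightarrow> complex" where
  "fourier2 F q = (LINT p|lborel. F p * exp (- 2 * pi * \<i> * complex_of_real (fst p * fst q + snd p * snd q)))"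

definition strictly_pos_def :: "(real \<times> real \<Rightarrow> complex) \<Rightarrow> bool" where
  "strictly_pos_def \<phi> \<longleftrightarrow> continuous_on UNIV \<phi> \<and>
    (\<forall>(M::nat) (x :: nat \<Rightarrow> real \<times> real) (c :: nat \<Rightarrow> complex). inj_on x {..<M} \<longrightarrow>
       (let s = (\<Sum>j<M. \<Sum>k<M. c j * cnj (c k) * \<phi> (x j - x k)) in
          Im s = 0 \<and> Re s \<ge> 0 \<and> (s = 0 \<longrightarrow> (\<forall>k<M. c k = 0))))"

end

theory Submission
  imports Defs "HOL-Probability.Characteristic_Functions"
begin

text \<open>Write \<open>f\<^sub>k = M\<^bsub>b\<^sub>k\<^esub>T\<^bsub>a\<^sub>k\<^esub> g\<close>, \<open>\<pi>(p) = M\<^sub>bT\<^sub>a\<close> for \<open>p = (a, b)\<close>, and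
  \<open>H = G\<^sub>N\<^sup>-\<^sup>1\<close>. The entries of \<open>u(p)\<close> are \<open>V\<^sub>g f\<^sub>k(p) = \<langle>f\<^sub>k, \<pi>(p) g\<rangle>\<close>, so \<open>F(p)\<close> is the squared norm of the
  projection of \<open>\<pi>(p) g\<close> onto the span of the \<open>f\<^sub>k\<close>, which gives (i), and it is the combination
  \<open>\<Sum>\<^sub>j\<^sub>k H\<^sub>j\<^sub>k V\<^sub>g f\<^sub>k \<cdot> cnj (V\<^sub>g f\<^sub>j)\<close>. The orthogonality relations for the short-time Fourier transform, which
  come from Plancherel's theorem in the frequency variable, turn its integral into
  \<open>tr (H G\<^sub>N) = N\<close>. Multiplying \<open>V\<^sub>g f\<^sub>k\<close> by a character of the plane amounts to shifting both \<open>g\<close> and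
  \<open>f\<^sub>k\<close>, so the same relations express the Fourier transform of \<open>F\<close> through products of two
  square-integrable short-time Fourier transforms; hence it is integrable. It is strictly positive
  definite because \<open>F\<close> is non-negative, continuous and not zero, and a trigonometric polynomial
  vanishing on a ball has only zero coefficients. Continuity of translations and modulations in
  \<open>L\<^sup>2\<close> makes \<open>F\<close> uniformly continuous, and together with integrability this forces decay at
  infinity. The determinant formula is the Schur complement.\<close>

section \<open>Square-integrable functions and continuity of translation\<close>

text \<open>The measure is left general because the notion serves both for functions on the line and
  for short-time Fourier transforms on the plane.\<close>

definition sq_integrable :: "'a measure \<Rightarrow> ('a \<Rightarrow> complex) \<Rightarrow> bool" where
  "sq_integrable M f \<longleftrightarrow> f \<in> borel_measurable M \<and> integrable M (\<lambda>x. (cmod (f x))\<^sup>2)"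

definition norm_L2 :: "'a measure \<Rightarrow> ('a \<Rightarrow> complex) \<Rightarrow> real" where
  "norm_L2 M f = sqrt (LINT x|M. (cmod (f x))\<^sup>2)"

lemma sq_integrable_measurable [measurable_dest]:
  "sq_integrable M f \<Longrightarrow> f \<in> borel_measurable M"
  by (simp add: sq_integrable_def)

lemma sq_integrable_norm_sq: "sq_integrable M f \<Longrightarrow> integrable M (\<lambda>x. (cmod (f x))\<^sup>2)"
  by (simp add: sq_integrable_def)

lemma norm_L2_nonneg [simp]: "0 \<le> norm_L2 M f"
  by (simp add: norm_L2_def)

lemma norm_L2_sq: "(norm_L2 M f)\<^sup>2 = (LINT x|M. (cmod (f x))\<^sup>2)"
  by (simp add: norm_L2_def)

lemma cmod_add_sq_le: "(cmod (x + y))\<^sup>2 \<le> 2 * (cmod x)\<^sup>2 + 2 * (cmod y)\<^sup>2"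
proof -
  have "(cmod (x + y))\<^sup>2 \<le> (cmod x + cmod y)\<^sup>2"
    by (intro power_mono norm_triangle_ineq) simp
  also have "\<dots> \<le> 2 * (cmod x)\<^sup>2 + 2 * (cmod y)\<^sup>2"
    using sum_squares_bound[of "cmod x" "cmod y"] by (simp add: power2_sum)
  finally show ?thesis .
qed

lemma cmod_mult_le_sq: "cmod (x * y) \<le> (cmod x)\<^sup>2 + (cmod y)\<^sup>2"
proof -
  have "0 \<le> cmod x * cmod y" by simp
  then show ?thesis
    using sum_squares_bound[of "cmod x" "cmod y"] unfolding norm_mult by linarith
qed

lemma sq_integrable_bound:
  assumes "f \<in> borel_measurable M" "integrable M h" "\<And>x. (cmod (f x))\<^sup>2 \<le> h x"
  shows "sq_integrable M f"
  unfolding sq_integrable_def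
proof
  note [measurable] = assms(1)
  show "integrable M (\<lambda>x. (cmod (f x))\<^sup>2)"
    by (rule Bochner_Integration.integrable_bound[OF assms(2)])
      (use assms(3) in \<open>auto intro: order_trans[OF _ abs_ge_self]\<close>)
qed (rule assms(1))

lemma sq_integrable_add:
  assumes "sq_integrable M f" "sq_integrable M h"
  shows "sq_integrable M (\<lambda>x. f x + h x)"
proof (rule sq_integrable_bound)
  show "integrable M (\<lambda>x. 2 * (cmod (f x))\<^sup>2 + 2 * (cmod (h x))\<^sup>2)"
    using assms by (auto simp: sq_integrable_def)
qed (use assms in \<open>auto simp: sq_integrable_def intro: cmod_add_sq_le\<close>)

lemma sq_integrable_cmult:
  assumes "sq_integrable M f"
  shows "sq_integrable M (\<lambda>x. c * f x)"
  using assms by (auto simp: sq_integrable_def norm_mult power_mult_distrib)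

lemma sq_integrable_diff:
  assumes "sq_integrable M f" "sq_integrable M h"
  shows "sq_integrable M (\<lambda>x. f x - h x)"
  using sq_integrable_add[OF assms(1) sq_integrable_cmult[OF assms(2), of "-1"]] by simp

lemma cnj_measurable [measurable]: "cnj \<in> borel_measurable borel"
  by (intro borel_measurable_continuous_onI continuous_intros)

lemma sq_integrable_cnj:
  assumes "sq_integrable M f"
  shows "sq_integrable M (\<lambda>x. cnj (f x))"
proof -
  note [measurable] = sq_integrable_measurable[OF assms]
  show ?thesis using sq_integrable_norm_sq[OF assms] by (simp add: sq_integrable_def)
qed

lemma sq_integrable_sum:
  assumes "\<And>i. i \<in> I \<Longrightarrow> sq_integrable M (f i)"
  shows "sq_integrable M (\<lambda>x. \<Sum>i\<in>I. f i x)"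
  using assms
proof (induction I rule: infinite_finite_induct)
  case (insert i I)
  then show ?case by (auto intro!: sq_integrable_add)
qed (auto simp: sq_integrable_def)

lemma sq_integrable_mult_integrable:
  assumes "sq_integrable M f" "sq_integrable M h"
  shows "integrable M (\<lambda>x. f x * h x)"
proof (rule Bochner_Integration.integrable_bound)
  show "integrable M (\<lambda>x. (cmod (f x))\<^sup>2 + (cmod (h x))\<^sup>2)"
    using assms by (auto simp: sq_integrable_def)
  show "(\<lambda>x. f x * h x) \<in> borel_measurable M"
    using assms by (auto simp: sq_integrable_def)
  show "AE x in M. norm (f x * h x) \<le> norm ((cmod (f x))\<^sup>2 + (cmod (h x))\<^sup>2)"
    using cmod_mult_le_sq by (auto simp: abs_of_nonneg)
qed

lemma sq_integrable_mult_cnj_integrable: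
  assumes "sq_integrable M f" "sq_integrable M h"
  shows "integrable M (\<lambda>x. f x * cnj (h x))"
  using sq_integrable_mult_integrable[OF assms(1) sq_integrable_cnj[OF assms(2)]] .

text \<open>For non-negative integrals the inequality holds without any finiteness. Square
  integrability makes all three integrals finite, so it passes to the reals.\<close>

lemma Cauchy_Schwarz_L2:
  assumes f: "sq_integrable M f" and h: "sq_integrable M h"
  shows "(LINT x|M. cmod (f x * h x)) \<le> norm_L2 M f * norm_L2 M h"
proof -
  note [measurable] = sq_integrable_measurable[OF f] sq_integrable_measurable[OF h]
  have i: "integrable M (\<lambda>x. cmod (f x * h x))"
    using sq_integrable_mult_integrable[OF f h] by (rule integrable_norm)
  have "(\<integral>\<^sup>+x. ennreal (cmod (f x)) * ennreal (cmod (h x)) \<partial>M)\<^sup>2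
     \<le> (\<integral>\<^sup>+x. ennreal (cmod (f x)) ^ 2 \<partial>M) * (\<integral>\<^sup>+x. ennreal (cmod (h x)) ^ 2 \<partial>M)"
    by (rule Cauchy_Schwarz_nn_integral) auto
  also have "(\<integral>\<^sup>+x. ennreal (cmod (f x)) * ennreal (cmod (h x)) \<partial>M) = ennreal (LINT x|M. cmod (f x * h x))"
    using nn_integral_eq_integral[OF i] by (simp add: norm_mult ennreal_mult)
  also have "(\<integral>\<^sup>+x. ennreal (cmod (f x)) ^ 2 \<partial>M) = ennreal ((norm_L2 M f)\<^sup>2)"
    using nn_integral_eq_integral[OF sq_integrable_norm_sq[OF f]] by (simp add: norm_L2_sq ennreal_power)
  also have "(\<integral>\<^sup>+x. ennreal (cmod (h x)) ^ 2 \<partial>M) = ennreal ((norm_L2 M h)\<^sup>2)"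
    using nn_integral_eq_integral[OF sq_integrable_norm_sq[OF h]] by (simp add: norm_L2_sq ennreal_power)
  finally have "(LINT x|M. cmod (f x * h x))\<^sup>2 \<le> (norm_L2 M f)\<^sup>2 * (norm_L2 M h)\<^sup>2"
    by (simp add: ennreal_power flip: ennreal_mult)
  then have "(LINT x|M. cmod (f x * h x))\<^sup>2 \<le> (norm_L2 M f * norm_L2 M h)\<^sup>2"
    by (simp add: power_mult_distrib)
  then show ?thesis
    by (rule power2_le_imp_le) simp
qed

lemma cmod_integral_mult_le:
  assumes "sq_integrable M f" "sq_integrable M h"
  shows "cmod (LINT x|M. f x * h x) \<le> norm_L2 M f * norm_L2 M h"
  using integral_norm_bound Cauchy_Schwarz_L2[OF assms] by (rule order_trans)

lemma norm_L2_cnj [simp]: "norm_L2 M (\<lambda>x. cnj (f x)) = norm_L2 M f"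
  by (simp add: norm_L2_def)

lemma cmod_integral_mult_cnj_le:
  assumes "sq_integrable M f" "sq_integrable M h"
  shows "cmod (LINT x|M. f x * cnj (h x)) \<le> norm_L2 M f * norm_L2 M h"
  using cmod_integral_mult_le[OF assms(1) sq_integrable_cnj[OF assms(2)]] by simp

lemma norm_L2_add_le:
  assumes f: "sq_integrable M f" and h: "sq_integrable M h"
  shows "norm_L2 M (\<lambda>x. f x + h x) \<le> norm_L2 M f + norm_L2 M h"
proof (rule power2_le_imp_le)
  have pw: "(cmod (z + w))\<^sup>2 \<le> (cmod z)\<^sup>2 + (cmod w)\<^sup>2 + 2 * cmod (z * w)" for z w
    using power_mono[OF norm_triangle_ineq[of z w], of 2] by (simp add: power2_sum norm_mult)
  have if2: "integrable M (\<lambda>x. (cmod (f x))\<^sup>2)" and ih2: "integrable M (\<lambda>x. (cmod (h x))\<^sup>2)"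
    using f h by (auto simp: sq_integrable_def)
  have ifh: "integrable M (\<lambda>x. cmod (f x * h x))"
    using sq_integrable_mult_integrable[OF f h] by (rule integrable_norm)
  have "(norm_L2 M (\<lambda>x. f x + h x))\<^sup>2 = (LINT x|M. (cmod (f x + h x))\<^sup>2)"
    by (rule norm_L2_sq)
  also have "\<dots> \<le> (LINT x|M. (cmod (f x))\<^sup>2 + (cmod (h x))\<^sup>2 + 2 * cmod (f x * h x))"
    using sq_integrable_norm_sq[OF sq_integrable_add[OF f h]] if2 ih2 ifh
    by (intro integral_mono pw) auto
  also have "\<dots> = (norm_L2 M f)\<^sup>2 + (norm_L2 M h)\<^sup>2 + 2 * (LINT x|M. cmod (f x * h x))"
    using if2 ih2 ifh by (simp add: norm_L2_sq)
  also have "\<dots> \<le> (norm_L2 M f + norm_L2 M h)\<^sup>2"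
    using Cauchy_Schwarz_L2[OF f h] by (simp add: power2_sum)
  finally show "(norm_L2 M (\<lambda>x. f x + h x))\<^sup>2 \<le> (norm_L2 M f + norm_L2 M h)\<^sup>2" .
qed simp

lemma norm_L2_cmult: "norm_L2 M (\<lambda>x. c * f x) = cmod c * norm_L2 M f"
  by (simp add: norm_L2_def norm_mult power_mult_distrib real_sqrt_mult)

lemma norm_L2_unimodular:
  assumes "\<And>x. cmod (c x) = 1"
  shows "norm_L2 M (\<lambda>x. c x * f x) = norm_L2 M f"
  by (simp add: norm_L2_def norm_mult assms)

lemma sq_integrable_unimodular:
  assumes "sq_integrable M f" "c \<in> borel_measurable M" "\<And>x. cmod (c x) = 1"
  shows "sq_integrable M (\<lambda>x. c x * f x)"
  using assms by (auto simp: sq_integrable_def norm_mult)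

section \<open>Translations on the line and their continuity in mean square\<close>

lemma integral_translate:
  fixes f :: "real \<Rightarrow> 'a :: {banach, second_countable_topology}"
  shows "(LINT t|lborel. f (t - r)) = (LINT t|lborel. f t)"
  using lborel_integral_real_affine[of 1 f "-r"] by (simp add: algebra_simps)

lemma integrable_translate:
  fixes f :: "real \<Rightarrow> 'a :: {banach, second_countable_topology}"
  assumes "integrable lborel f"
  shows "integrable lborel (\<lambda>t. f (t - r))"
  using lborel_integrable_real_affine[OF assms, of 1 "-r"] by (simp add: algebra_simps)

lemma sq_integrable_translate:
  fixes f :: "real \<Rightarrow> complex"
  assumes "sq_integrable lborel f"
  shows "sq_integrable lborel (\<lambda>t. f (t - r))"
  using assms integrable_translate[of "\<lambda>t. (cmod (f t))\<^sup>2" r]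
  by (auto simp: sq_integrable_def)

lemma norm_L2_translate:
  fixes f :: "real \<Rightarrow> complex"
  shows "norm_L2 lborel (\<lambda>t. f (t - r)) = norm_L2 lborel f"
  using integral_translate[of "\<lambda>t. (cmod (f t))\<^sup>2" r] by (simp add: norm_L2_def)

lemma norm_L2_tendsto_0:
  fixes f :: "nat \<Rightarrow> real \<Rightarrow> complex"
  assumes "\<And>n. f n \<in> borel_measurable lborel" "AE t in lborel. (\<lambda>n. f n t) \<longlonglongrightarrow> 0"
    and "integrable lborel w" "\<And>n t. (cmod (f n t))\<^sup>2 \<le> w t"
  shows "(\<lambda>n. norm_L2 lborel (f n)) \<longlonglongrightarrow> 0"
proof -
  have "(\<lambda>n. LINT t|lborel. (cmod (f n t))\<^sup>2) \<longlonglongrightarrow> (LINT t::real|lborel. 0)"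
  proof (rule integral_dominated_convergence[where w = w])
    show "AE t in lborel. (\<lambda>n. (cmod (f n t))\<^sup>2) \<longlonglongrightarrow> 0"
      using assms(2) by eventually_elim (auto intro!: tendsto_eq_intros)
  qed (use assms in auto)
  then have "(\<lambda>n. sqrt (LINT t|lborel. (cmod (f n t))\<^sup>2)) \<longlonglongrightarrow> sqrt 0"
    by (intro tendsto_real_sqrt) simp
  then show ?thesis by (simp add: norm_L2_def)
qed

text \<open>Continuity at \<open>0\<close> of the map from a shift to the translate of
  \<open>f\<close>, in sequential form so that dominated convergence applies directly.\<close>

definition translation_continuous :: "(real \<Rightarrow> complex) \<Rightarrow> bool" where
  "translation_continuous f \<longleftrightarrow>
     (\<forall>r. r \<longlonglongrightarrow> 0 \<longrightarrow> (\<lambda>n. norm_L2 lborel (\<lambda>t. f (t - r n) - f t)) \<longlonglongrightarrow> 0)"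

text \<open>A three-epsilon argument: translation is an isometry, so one approximation error bounds
  both outer terms, uniformly in the shift.\<close>

lemma translation_continuous_approx:
  assumes f: "sq_integrable lborel f"
    and h: "\<And>n. sq_integrable lborel (h n)" "\<And>n. translation_continuous (h n)"
    and lim: "(\<lambda>n. norm_L2 lborel (\<lambda>t. f t - h n t)) \<longlonglongrightarrow> 0"
  shows "translation_continuous f"
  unfolding translation_continuous_def
proof (intro allI impI)
  fix r :: "nat \<Rightarrow> real" assume r: "r \<longlonglongrightarrow> 0"
  show "(\<lambda>n. norm_L2 lborel (\<lambda>t. f (t - r n) - f t)) \<longlonglongrightarrow> 0"
  proof (rule LIMSEQ_I)
    fix e :: real assume e: "0 < e"
    obtain m where m: "norm_L2 lborel (\<lambda>t. f t - h m t) < e / 3"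
      using LIMSEQ_D[OF lim, of "e / 3"] e by auto
    have "(\<lambda>n. norm_L2 lborel (\<lambda>t. h m (t - r n) - h m t)) \<longlonglongrightarrow> 0"
      using h(2) r by (auto simp: translation_continuous_def)
    then obtain n0 where n0: "\<And>n. n \<ge> n0 \<Longrightarrow> norm_L2 lborel (\<lambda>t. h m (t - r n) - h m t) < e / 3"
      using order_tendstoD(2)[of _ 0 sequentially "e / 3"] e unfolding eventually_sequentially by force
    have "norm_L2 lborel (\<lambda>t. f (t - r n) - f t) < e" if n: "n \<ge> n0" for n
    proof -
      have d: "sq_integrable lborel (\<lambda>t. f t - h m t)"
        by (rule sq_integrable_diff[OF f h(1)])
      note d' = sq_integrable_translate[OF d, of "r n"]
      have d'': "sq_integrable lborel (\<lambda>t. h m (t - r n) - h m t)"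
        by (rule sq_integrable_diff[OF sq_integrable_translate h(1)]) (rule h(1))
      have m1: "sq_integrable lborel (\<lambda>t. - 1 * (f t - h m t))"
        by (rule sq_integrable_cmult[OF d])
      have "norm_L2 lborel (\<lambda>t. f (t - r n) - f t)
        = norm_L2 lborel (\<lambda>t. (f (t - r n) - h m (t - r n)) + ((h m (t - r n) - h m t) + (- 1) * (f t - h m t)))"
        by (simp add: algebra_simps)
      also have "\<dots> \<le> norm_L2 lborel (\<lambda>t. f (t - r n) - h m (t - r n)) +
          norm_L2 lborel (\<lambda>t. (h m (t - r n) - h m t) + (- 1) * (f t - h m t))"
        by (rule norm_L2_add_le[OF d' sq_integrable_add[OF d'' m1]])
      also have "\<dots> \<le> norm_L2 lborel (\<lambda>t. f (t - r n) - h m (t - r n)) +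
          (norm_L2 lborel (\<lambda>t. h m (t - r n) - h m t) + norm_L2 lborel (\<lambda>t. (- 1) * (f t - h m t)))"
        using norm_L2_add_le[OF d'' m1] by simp
      also have "\<dots> < e / 3 + (e / 3 + e / 3)"
        using m n0[OF n] norm_L2_translate[of "\<lambda>t. f t - h m t" "r n"]
          norm_L2_cmult[of lborel "-1" "\<lambda>t. f t - h m t"]
        by simp
      finally show ?thesis by simp
    qed
    then show "\<exists>n0. \<forall>n\<ge>n0. norm (norm_L2 lborel (\<lambda>t. f (t - r n) - f t) - 0) < e"
      by auto
  qed
qed

lemma integrable_indicator_interval: "integrable lborel (\<lambda>t::real. C * indicator {a..b} t :: real)"
  by (intro integrable_mult_right integrable_real_indicator) (auto simp: emeasure_lborel_Icc_eq)

lemma sq_integrable_bounded_support: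
  fixes f :: "real \<Rightarrow> complex"
  assumes "f \<in> borel_measurable lborel" "\<And>t. cmod (f t) \<le> B" "\<And>t. R < \<bar>t\<bar> \<Longrightarrow> f t = 0"
  shows "sq_integrable lborel f"
proof (rule sq_integrable_bound[OF assms(1) integrable_indicator_interval[of "B\<^sup>2" "-R" R]])
  fix t show "(cmod (f t))\<^sup>2 \<le> B\<^sup>2 * indicator {-R..R} t"
    using assms(2)[of t] assms(3)[of t] by (cases "\<bar>t\<bar> \<le> R") (auto simp: indicator_def abs_le_iff intro!: power_mono)
qed

text \<open>Dominated convergence: continuity gives the pointwise limit, and boundedness with
  bounded support gives the dominating function.\<close>

lemma translation_continuous_continuous:
  assumes c: "continuous_on UNIV f" and B: "\<And>t. cmod (f t) \<le> B" and R: "\<And>t. R < \<bar>t\<bar> \<Longrightarrow> f t = 0"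
  shows "translation_continuous f"
  unfolding translation_continuous_def
proof (intro allI impI)
  fix r :: "nat \<Rightarrow> real" assume r: "r \<longlonglongrightarrow> 0"
  have [measurable]: "f \<in> borel_measurable borel" using c by (rule borel_measurable_continuous_onI)
  \<comment> \<open>A convergent sequence of shifts is bounded, so all translates vanish outside one
    interval, enlarged by \<open>D\<close>.\<close>
  obtain D where D: "\<And>n. \<bar>r n\<bar> \<le> D"
    using convergent_imp_Bseq[of r] r by (auto simp: convergent_def Bseq_def)
  show "(\<lambda>n. norm_L2 lborel (\<lambda>t. f (t - r n) - f t)) \<longlonglongrightarrow> 0"
  proof (rule norm_L2_tendsto_0)
    show "integrable lborel (\<lambda>t. (2 * B)\<^sup>2 * indicator {-(R + D)..R + D} t)"
      by (rule integrable_indicator_interval)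
    show "AE t in lborel. (\<lambda>n. f (t - r n) - f t) \<longlonglongrightarrow> 0"
    proof (rule AE_I2)
      fix t
      have "(\<lambda>n. f (t - r n)) \<longlonglongrightarrow> f t"
        using c by (rule continuous_on_tendsto_compose) (auto intro!: tendsto_eq_intros r)
      then show "(\<lambda>n. f (t - r n) - f t) \<longlonglongrightarrow> 0"
        using LIM_zero by blast
    qed
    fix n t
    show "(cmod (f (t - r n) - f t))\<^sup>2 \<le> (2 * B)\<^sup>2 * indicator {-(R + D)..R + D} t"
    proof (cases "\<bar>t\<bar> \<le> R + D")
      case True
      have "cmod (f (t - r n) - f t) \<le> 2 * B"
        using norm_triangle_ineq4[of "f (t - r n)" "f t"] B[of t] B[of "t - r n"] by simp
      then have "(cmod (f (t - r n) - f t))\<^sup>2 \<le> (2 * B)\<^sup>2" by (intro power_mono) auto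
      with True show ?thesis by (auto simp: indicator_def)
    next
      case False
      then have "f t = 0" "f (t - r n) = 0"
        using D[of n] by (auto intro!: R)
      then show ?thesis by (auto simp: indicator_def)
    qed
  qed measurable
qed

text \<open>Measurability supplies continuous functions converging to \<open>f\<close> almost
  everywhere. Truncated to a common bound and a common support, they converge in mean square as
  well.\<close>

lemma translation_continuous_bounded:
  assumes f[measurable]: "f \<in> borel_measurable lborel"
    and B: "\<And>t. cmod (f t) \<le> B" and R: "\<And>t. R < \<bar>t\<bar> \<Longrightarrow> f t = 0" and "0 < B"
  shows "translation_continuous f"
proof -
  have "f \<in> borel_measurable lebesgue"
    using f by (simp add: measurable_completion)
  then have "f measurable_on UNIV"
    by (rule lebesgue_measurable_imp_measurable_on) simp
  then obtain S h where S: "negligible S" and h: "\<And>n. continuous_on UNIV (h n)"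
    and lim: "\<And>t. t \<notin> S \<Longrightarrow> (\<lambda>n. h n t) \<longlonglongrightarrow> f t"
    unfolding measurable_on_def by auto
  \<comment> \<open>The first factor is a cutoff, \<open>1\<close> on \<open>[-R, R]\<close> and
    \<open>0\<close> beyond \<open>R + 1\<close>; the second retracts values radially onto the disc
    of radius \<open>B\<close>. Both leave the values of \<open>f\<close> unchanged, so the limit is
    still \<open>f\<close>.\<close>
  define k where "k n t = complex_of_real (max 0 (min 1 (R + 1 - \<bar>t\<bar>)) / max 1 (cmod (h n t) / B)) * h n t" for n t
  have kc: "continuous_on UNIV (k n)" for n
    unfolding k_def by (intro continuous_intros h) (use \<open>0 < B\<close> in \<open>auto simp: max_def\<close>)
  have kB: "cmod (k n t) \<le> B" for n t
  proof -
    have "cmod (k n t) = max 0 (min 1 (R + 1 - \<bar>t\<bar>)) * (cmod (h n t) / max 1 (cmod (h n t) / B))"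
      unfolding k_def norm_mult norm_of_real by (subst abs_of_nonneg) auto
    also have "\<dots> \<le> 1 * (cmod (h n t) / max 1 (cmod (h n t) / B))"
      by (intro mult_right_mono) auto
    also have "\<dots> \<le> B"
      using \<open>0 < B\<close> by (auto simp: max_def field_simps)
    finally show ?thesis .
  qed
  have kR: "k n t = 0" if "R + 1 < \<bar>t\<bar>" for n t
    using that by (simp add: k_def)
  show ?thesis
  proof (rule translation_continuous_approx[where h = k])
    show sf: "sq_integrable lborel f"
      by (rule sq_integrable_bounded_support[OF f B R])
    show "sq_integrable lborel (k n)" for n
      using borel_measurable_continuous_onI[OF kc] by (intro sq_integrable_bounded_support[OF _ kB kR]) auto
    show "translation_continuous (k n)" for n
      by (rule translation_continuous_continuous[OF kc kB kR])
    show "(\<lambda>n. norm_L2 lborel (\<lambda>t. f t - k n t)) \<longlonglongrightarrow> 0"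
    proof (rule norm_L2_tendsto_0)
      show "integrable lborel (\<lambda>t. (2 * B)\<^sup>2 * indicator {-(R + 1)..R + 1} t)"
        by (rule integrable_indicator_interval)
      show "(\<lambda>t. f t - k n t) \<in> borel_measurable lborel" for n
        using borel_measurable_continuous_onI[OF kc[of n]] by auto
      show "(cmod (f t - k n t))\<^sup>2 \<le> (2 * B)\<^sup>2 * indicator {-(R + 1)..R + 1} t" for n t
      proof (cases "\<bar>t\<bar> \<le> R + 1")
        case True
        have "cmod (f t - k n t) \<le> 2 * B"
          using norm_triangle_ineq4[of "f t" "k n t"] B[of t] kB[of n t] by simp
        then have "(cmod (f t - k n t))\<^sup>2 \<le> (2 * B)\<^sup>2" by (intro power_mono) auto
        with True show ?thesis by (auto simp: indicator_def)
      next
        case False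
        then show ?thesis using R[of t] kR[of t n] by (auto simp: indicator_def)
      qed
      have "AE t in lebesgue. t \<notin> S"
        using S by (simp add: AE_not_in negligible_iff_null_sets)
      then have "AE t in lborel. t \<notin> S"
        by (simp add: AE_completion_iff)
      then show "AE t in lborel. (\<lambda>n. f t - k n t) \<longlonglongrightarrow> 0"
      proof eventually_elim
        fix t assume t: "t \<notin> S"
        have "(\<lambda>n. k n t) \<longlonglongrightarrow> complex_of_real (max 0 (min 1 (R + 1 - \<bar>t\<bar>)) / max 1 (cmod (f t) / B)) * f t"
          unfolding k_def by (intro tendsto_intros lim t) (use assms in auto)
        also have "complex_of_real (max 0 (min 1 (R + 1 - \<bar>t\<bar>)) / max 1 (cmod (f t) / B)) * f t = f t"
        proof (cases "\<bar>t\<bar> \<le> R")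
          case True
          then show ?thesis using B[of t] \<open>0 < B\<close> by (simp add: max_def)
        qed (use R[of t] in simp)
        finally have "(\<lambda>n. f t - k n t) \<longlonglongrightarrow> f t - f t" by (intro tendsto_intros)
        then show "(\<lambda>n. f t - k n t) \<longlonglongrightarrow> 0" by simp
      qed
    qed
  qed
qed

text \<open>Cutting off large values and large arguments reduces to the bounded case; the errors are
  dominated by \<open>f\<close> itself.\<close>

lemma sq_integrable_translation_continuous:
  assumes f: "sq_integrable lborel f"
  shows "translation_continuous f"
proof -
  note [measurable] = sq_integrable_measurable[OF f]
  define h where "h n t = (if cmod (f t) \<le> real n \<and> \<bar>t\<bar> \<le> real n then f t else 0)" for n t
  have hm[measurable]: "h n \<in> borel_measurable lborel" for n
    unfolding h_def by measurable
  \<comment> \<open>The bound is \<open>real n + 1\<close> because the bounded case asks for a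
    positive bound and \<open>n\<close> may be \<open>0\<close>.\<close>
  have hB: "cmod (h n t) \<le> real n + 1" and hR: "real n < \<bar>t\<bar> \<Longrightarrow> h n t = 0" for n t
    by (auto simp: h_def)
  show ?thesis
  proof (rule translation_continuous_approx[OF f, where h = h])
    show "sq_integrable lborel (h n)" for n
      by (rule sq_integrable_bounded_support[OF hm hB hR])
    show "translation_continuous (h n)" for n
      by (rule translation_continuous_bounded[OF hm hB hR]) auto
    show "(\<lambda>n. norm_L2 lborel (\<lambda>t. f t - h n t)) \<longlonglongrightarrow> 0"
    proof (rule norm_L2_tendsto_0)
      show "integrable lborel (\<lambda>t. (cmod (f t))\<^sup>2)" by (rule sq_integrable_norm_sq[OF f])
      show "AE t in lborel. (\<lambda>n. f t - h n t) \<longlonglongrightarrow> 0"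
      proof (rule AE_I2)
        fix t
        obtain m where m: "max (cmod (f t)) \<bar>t\<bar> \<le> real m" using real_arch_simple by blast
        have "eventually (\<lambda>n. f t - h n t = 0) sequentially"
          using eventually_ge_at_top[of m] by eventually_elim (use m in \<open>auto simp: h_def\<close>)
        then show "(\<lambda>n. f t - h n t) \<longlonglongrightarrow> 0" by (simp add: tendsto_eventually)
      qed
    qed (auto simp: h_def)
  qed
qed

section \<open>Plancherel's theorem\<close>

text \<open>The kernel as a homomorphism from the additive reals to the unit circle, so that phase
  computations become additions of arguments.\<close>

definition chr :: "real \<Rightarrow> complex" where
  "chr x = exp (- 2 * pi * \<i> * complex_of_real x)"

lemma chr_cis: "chr x = cis (- (2 * pi * x))"
  by (simp add: chr_def cis_conv_exp algebra_simps)

lemma chr_0 [simp]: "chr 0 = 1"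
  by (simp add: chr_def)

lemma chr_add: "chr (x + y) = chr x * chr y"
  by (simp add: chr_def exp_add[symmetric] algebra_simps)

lemma chr_minus: "chr (- x) = cnj (chr x)"
  by (simp add: chr_cis cis_cnj)

lemma cnj_chr [simp]: "cnj (chr x) = chr (- x)"
  by (simp add: chr_minus)

lemma chr_diff: "chr (x - y) = chr x * chr (- y)"
  using chr_add[of x "-y"] by simp

lemma chr_mult_inverse [simp]: "chr x * chr (- x) = 1" "chr (- x) * chr x = 1"
  by (simp_all flip: chr_add)

lemma cmod_chr [simp]: "cmod (chr x) = 1"
  by (simp add: chr_cis)

lemma continuous_on_chr [continuous_intros]:
  "continuous_on S f \<Longrightarrow> continuous_on S (\<lambda>x. chr (f x))"
  unfolding chr_def by (intro continuous_intros)

lemma tendsto_chr [tendsto_intros]: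
  "(f \<longlongrightarrow> x) G \<Longrightarrow> ((\<lambda>y. chr (f y)) \<longlongrightarrow> chr x) G"
  unfolding chr_def by (intro tendsto_intros)

lemma chr_measurable [measurable]: "chr \<in> borel_measurable borel"
  by (intro borel_measurable_continuous_onI continuous_intros)

text \<open>On a function that is not integrable this is the default value \<open>0\<close> of the
  Bochner integral, so Plancherel's identity below is confined to integrable functions.\<close>

definition ft :: "(real \<Rightarrow> complex) \<Rightarrow> real \<Rightarrow> complex" where
  "ft f y = (LINT t|lborel. f t * chr (y * t))"

lemma ft_measurable [measurable]:
  assumes [measurable]: "f \<in> borel_measurable borel"
  shows "ft f \<in> borel_measurable borel"
  unfolding ft_def by measurable

lemma cmod_ft_le:
  "cmod (ft f y) \<le> (LINT t|lborel. cmod (f t))"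
  unfolding ft_def using integral_norm_bound[of lborel "\<lambda>t. f t * chr (y * t)"] by (simp add: norm_mult)

lemma ft_integrable:
  assumes "integrable lborel f"
  shows "integrable lborel (\<lambda>t. f t * chr (y * t))"
  by (rule Bochner_Integration.integrable_bound[OF assms]) (use assms in \<open>auto simp: norm_mult\<close>)

section \<open>Gaussian regularisation and Plancherel's identity\<close>

lemma integral_std_normal_chr:
  "(LINT x|lborel. complex_of_real (std_normal_density x) * chr (y * x))
     = complex_of_real (exp (- (2 * pi * y)\<^sup>2 / 2))"
proof -
  have "char std_normal_distribution (- (2 * pi * y))
      = (LINT x|lborel. std_normal_density x *\<^sub>R iexp (- (2 * pi * y) * x))"
    unfolding char_def by (subst integral_density) auto
  also have "\<dots> = (LINT x|lborel. complex_of_real (std_normal_density x) * chr (y * x))"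
    by (intro Bochner_Integration.integral_cong refl) (simp add: chr_def scaleR_conv_of_real algebra_simps)
  finally show ?thesis
    by (simp add: char_std_normal_distribution)
qed

text \<open>Scaled so that its Fourier transform is the density of the centred normal law with
  standard deviation \<open>d\<close>. It increases pointwise to \<open>1\<close> as
  \<open>d\<close> decreases to \<open>0\<close>.\<close>

definition gweight :: "real \<Rightarrow> real \<Rightarrow> real" where
  "gweight d y = exp (- (2 * pi * d * y)\<^sup>2 / 2)"

lemma gweight_pos: "0 < gweight d y"
  by (simp add: gweight_def)

lemma gweight_measurable [measurable]: "gweight d \<in> borel_measurable borel"
  unfolding gweight_def by measurable

lemma gweight_eq: "gweight d y = sqrt (2 * pi) * std_normal_density (2 * pi * d * y)"
  by (simp add: gweight_def std_normal_density_def)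

lemma integrable_gweight:
  assumes "0 < d"
  shows "integrable lborel (gweight d)"
proof -
  have "integrable lborel (\<lambda>y. std_normal_density (0 + (2 * pi * d) * y))"
    using assms by (intro lborel_integrable_real_affine) auto
  then have "integrable lborel (\<lambda>y. sqrt (2 * pi) * std_normal_density (2 * pi * d * y))"
    by (intro integrable_mult_right) simp
  then show ?thesis by (simp add: gweight_eq[abs_def])
qed

text \<open>The substitution \<open>x = 2 * pi * d * y\<close> reduces this to the characteristic
  function of the standard normal law.\<close>

lemma integral_gweight_chr:
  assumes d: "0 < d"
  shows "(LINT y|lborel. complex_of_real (gweight d y) * chr (y * r))
    = complex_of_real (std_normal_density (r / d) / d)"
proof -
  let ?f = "\<lambda>x. complex_of_real (std_normal_density x) * chr ((r / (2 * pi * d)) * x)"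
  have "(LINT x|lborel. ?f x) = \<bar>2 * pi * d\<bar> *\<^sub>R (LINT y|lborel. ?f (0 + (2 * pi * d) * y))"
    using d by (intro lborel_integral_real_affine) auto
  also have "(LINT y|lborel. ?f (0 + (2 * pi * d) * y))
    = (LINT y|lborel. (1 / sqrt (2 * pi)) * (complex_of_real (gweight d y) * chr (y * r)))"
  proof (intro Bochner_Integration.integral_cong refl)
    fix y
    have "r / (2 * pi * d) * (0 + (2 * pi * d) * y) = y * r" using d by simp
    then show "?f (0 + (2 * pi * d) * y) = (1 / sqrt (2 * pi)) * (complex_of_real (gweight d y) * chr (y * r))"
      by (simp add: gweight_eq)
  qed
  also have "\<dots> = (1 / sqrt (2 * pi)) * (LINT y|lborel. complex_of_real (gweight d y) * chr (y * r))"
    by simp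
  finally have "(LINT y|lborel. complex_of_real (gweight d y) * chr (y * r))
     = sqrt (2 * pi) / (2 * pi * d) * complex_of_real (exp (- (2 * pi * (r / (2 * pi * d)))\<^sup>2 / 2))"
    unfolding integral_std_normal_chr using d by (simp add: scaleR_conv_of_real field_simps)
  also have "sqrt (2 * pi) / (2 * pi * d) = 1 / (sqrt (2 * pi) * d)"
    using d real_sqrt_mult_self[of "2 * pi"] by (simp add: field_simps del: real_sqrt_mult_self)
  also have "2 * pi * (r / (2 * pi * d)) = r / d" by simp
  finally show ?thesis
    by (simp add: std_normal_density_def)
qed

lemma integrable_pair_mult:
  fixes f h :: "real \<Rightarrow> complex"
  assumes "integrable lborel f" "integrable lborel h"
  shows "integrable (lborel \<Otimes>\<^sub>M lborel) (\<lambda>(x, y). f x * h y)"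
proof (rule lborel_pair.Fubini_integrable)
  note [measurable] = borel_measurable_integrable[OF assms(1)] borel_measurable_integrable[OF assms(2)]
  show "(\<lambda>(x, y). f x * h y) \<in> borel_measurable (lborel \<Otimes>\<^sub>M lborel)" by measurable
  show "integrable lborel (\<lambda>x. LINT y|lborel. norm (case (x, y) of (x, y) \<Rightarrow> f x * h y))"
    using assms by (simp add: norm_mult)
  show "AE x in lborel. integrable lborel (\<lambda>y. case (x, y) of (x, y) \<Rightarrow> f x * h y)"
    using assms by simp
qed

lemma Fubini_swap:
  fixes F :: "real \<Rightarrow> real \<Rightarrow> complex"
  assumes "integrable (lborel \<Otimes>\<^sub>M lborel) (\<lambda>(x, y). F x y)"
  shows "(LINT x|lborel. LINT y|lborel. F x y) = (LINT y|lborel. LINT x|lborel. F x y)"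
  using lborel_pair.Fubini_integral[OF assms] by simp

text \<open>The weight makes the integrals absolutely convergent, so the frequency can be integrated
  out first. This leaves a Gaussian kernel of width \<open>d\<close>, hence a normal average of the
  autocorrelation of \<open>f\<close>.\<close>

lemma integral_gweight_ft:
  assumes f: "integrable lborel f" and f2: "sq_integrable lborel f" and d: "0 < d"
  shows "(LINT y|lborel. gweight d y * (cmod (ft f y))\<^sup>2)
    = Re (LINT x|lborel. complex_of_real (std_normal_density x) * (LINT t|lborel. f t * cnj (f (t - d * x))))"
proof -
  note [measurable] = borel_measurable_integrable[OF f]
  let ?w = "\<lambda>y. complex_of_real (gweight d y)"
  have iw: "integrable lborel ?w" using integrable_gweight[OF d] by simp
  have iwf: "integrable lborel (\<lambda>y. ?w y * cnj (ft f y))"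
  proof (rule Bochner_Integration.integrable_bound)
    show "integrable lborel (\<lambda>y. gweight d y * (LINT t|lborel. cmod (f t)))"
      using integrable_gweight[OF d] by simp
    show "AE y in lborel. norm (?w y * cnj (ft f y)) \<le> norm (gweight d y * (LINT t|lborel. cmod (f t)))"
      using cmod_ft_le[of f] gweight_pos[of d]
      by (intro AE_I2) (auto simp: norm_mult abs_mult less_imp_le intro!: mult_left_mono order_trans[OF _ abs_ge_self])
  qed measurable
  \<comment> \<open>Fourier inversion smoothed at scale \<open>d\<close>: the weighted frequency
    integral is a Gaussian average of \<open>cnj f\<close> around \<open>s\<close>.\<close>
  have inner: "(LINT y|lborel. ?w y * cnj (ft f y) * chr (y * s))
       = (LINT x|lborel. cnj (f (s - d * x)) * complex_of_real (std_normal_density x))" for s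
  proof -
    have "(LINT y|lborel. ?w y * cnj (ft f y) * chr (y * s))
       = (LINT y|lborel. LINT t|lborel. ?w y * cnj (f t) * chr (y * (s - t)))"
      unfolding ft_def
      by (simp add: mult_ac right_diff_distrib chr_diff flip: integral_mult_right_zero integral_mult_left_zero Bochner_Integration.integral_cnj)
    also have "\<dots> = (LINT t|lborel. LINT y|lborel. ?w y * cnj (f t) * chr (y * (s - t)))"
    proof (rule Fubini_swap)
      have "integrable lborel (\<lambda>t. cnj (f t))" using f by simp
      from integrable_pair_mult[OF iw this]
      show "integrable (lborel \<Otimes>\<^sub>M lborel) (\<lambda>(y, t). ?w y * cnj (f t) * chr (y * (s - t)))"
        by (rule Bochner_Integration.integrable_bound) (auto simp: norm_mult split_beta)
    qed
    also have "\<dots> = (LINT t|lborel. cnj (f t) * (LINT y|lborel. ?w y * chr (y * (s - t))))"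
      by (simp add: mult_ac flip: integral_mult_right_zero)
    also have "\<dots> = (LINT t|lborel. cnj (f t) * complex_of_real (std_normal_density ((s - t) / d) / d))"
      by (simp only: integral_gweight_chr[OF d])
    \<comment> \<open>The substitution \<open>t = s - d * x\<close> absorbs the factor
      \<open>1 / d\<close> of the kernel and moves the scale into the argument of
      \<open>f\<close>.\<close>
    also have "\<dots> = \<bar>- d\<bar> *\<^sub>R (LINT x|lborel. cnj (f (s + - d * x)) * complex_of_real (std_normal_density ((s - (s + - d * x)) / d) / d))"
      using d by (intro lborel_integral_real_affine) auto
    also have "\<dots> = (LINT x|lborel. \<bar>- d\<bar> *\<^sub>R (cnj (f (s + - d * x)) * complex_of_real (std_normal_density ((s - (s + - d * x)) / d) / d)))"
      by simp
    also have "\<dots> = (LINT x|lborel. cnj (f (s - d * x)) * complex_of_real (std_normal_density x))"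
      using d by (intro Bochner_Integration.integral_cong refl) (simp add: scaleR_conv_of_real)
    finally show ?thesis .
  qed
  have "complex_of_real (LINT y|lborel. gweight d y * (cmod (ft f y))\<^sup>2)
     = (LINT y|lborel. ?w y * (ft f y * cnj (ft f y)))"
    by (simp flip: integral_complex_of_real complex_norm_square)
  also have "\<dots> = (LINT y|lborel. LINT s|lborel. (?w y * cnj (ft f y)) * f s * chr (y * s))"
    by (subst (1) ft_def) (simp add: mult_ac flip: integral_mult_right_zero integral_mult_left_zero)
  also have "\<dots> = (LINT s|lborel. LINT y|lborel. (?w y * cnj (ft f y)) * f s * chr (y * s))"
  proof (rule Fubini_swap)
    show "integrable (lborel \<Otimes>\<^sub>M lborel) (\<lambda>(y, s). (?w y * cnj (ft f y)) * f s * chr (y * s))"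
      by (rule Bochner_Integration.integrable_bound[OF integrable_pair_mult[OF iwf f]])
        (auto simp: norm_mult split_beta)
  qed
  also have "\<dots> = (LINT s|lborel. f s * (LINT y|lborel. ?w y * cnj (ft f y) * chr (y * s)))"
    by (simp add: mult_ac flip: integral_mult_right_zero)
  also have "\<dots> = (LINT s|lborel. f s * (LINT x|lborel. cnj (f (s - d * x)) * complex_of_real (std_normal_density x)))"
    by (simp only: inner)
  also have "\<dots> = (LINT s|lborel. LINT x|lborel. complex_of_real (std_normal_density x) * (f s * cnj (f (s - d * x))))"
    by (simp add: mult_ac flip: integral_mult_right_zero)
  also have "\<dots> = (LINT x|lborel. LINT s|lborel. complex_of_real (std_normal_density x) * (f s * cnj (f (s - d * x))))"
  proof (rule Fubini_swap[symmetric], rule lborel_pair.Fubini_integrable)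
    \<comment> \<open>Cauchy-Schwarz bounds the autocorrelation uniformly in \<open>x\<close>, so
      integrability of the normal density suffices for Fubini.\<close>
    have n: "(LINT t|lborel. cmod (f t * cnj (f (t - d * x)))) \<le> (norm_L2 lborel f)\<^sup>2" for x
      using Cauchy_Schwarz_L2[OF f2 sq_integrable_cnj[OF sq_integrable_translate[OF f2, of "d * x"]]]
      by (simp add: norm_L2_translate power2_eq_square)
    show "(\<lambda>(x, s). complex_of_real (std_normal_density x) * (f s * cnj (f (s - d * x)))) \<in> borel_measurable (lborel \<Otimes>\<^sub>M lborel)"
      by measurable
    show "integrable lborel (\<lambda>x. LINT s|lborel. norm (case (x, s) of (x, s) \<Rightarrow> complex_of_real (std_normal_density x) * (f s * cnj (f (s - d * x)))))"
    proof (rule Bochner_Integration.integrable_bound)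
      show "integrable lborel (\<lambda>x. std_normal_density x * (norm_L2 lborel f)\<^sup>2)" by simp
      show "AE x in lborel. norm (LINT s|lborel. norm (case (x, s) of (x, s) \<Rightarrow> complex_of_real (std_normal_density x) * (f s * cnj (f (s - d * x)))))
        \<le> norm (std_normal_density x * (norm_L2 lborel f)\<^sup>2)"
        using n by (auto simp: norm_mult abs_mult mult_left_mono)
    qed measurable
    show "AE x in lborel. integrable lborel (\<lambda>s. case (x, s) of (x, s) \<Rightarrow> complex_of_real (std_normal_density x) * (f s * cnj (f (s - d * x))))"
      using sq_integrable_mult_cnj_integrable[OF f2 sq_integrable_translate[OF f2]] by auto
  qed
  also have "\<dots> = (LINT x|lborel. complex_of_real (std_normal_density x) * (LINT t|lborel. f t * cnj (f (t - d * x))))"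
    by simp
  finally show ?thesis
    by (metis Re_complex_of_real)
qed

text \<open>Let \<open>d\<close> tend to \<open>0\<close> in \<open>integral_gweight_ft\<close>. The
  weights increase to \<open>1\<close>, while the averaged autocorrelation tends to its value at
  \<open>0\<close>, the squared norm, by continuity of translation in mean square.\<close>

theorem Plancherel:
  assumes f: "integrable lborel f" and f2: "sq_integrable lborel f"
  shows "has_bochner_integral lborel (\<lambda>y. (cmod (ft f y))\<^sup>2) (LINT t|lborel. (cmod (f t))\<^sup>2)"
proof -
  note [measurable] = borel_measurable_integrable[OF f]
  define d where "d n = inverse (real (Suc n))" for n
  have d: "d n > 0" for n by (simp add: d_def)
  have dlim: "d \<longlonglongrightarrow> 0" unfolding d_def by (rule LIMSEQ_inverse_real_of_nat)
  define A where "A r = (LINT t|lborel. f t * cnj (f (t - r)))" for r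
  have A0: "A 0 = complex_of_real (LINT t|lborel. (cmod (f t))\<^sup>2)"
    by (simp add: A_def flip: integral_complex_of_real complex_norm_square)
  have Ab: "cmod (A r) \<le> (norm_L2 lborel f)\<^sup>2" for r
    using cmod_integral_mult_cnj_le[OF f2 sq_integrable_translate[OF f2, of r]]
    by (simp add: A_def norm_L2_translate power2_eq_square)
  have Am[measurable]: "A \<in> borel_measurable borel" unfolding A_def by measurable
  have Alim: "(\<lambda>n. A (r n)) \<longlonglongrightarrow> A 0" if r: "r \<longlonglongrightarrow> 0" for r
  proof -
    have lim0: "(\<lambda>n. norm_L2 lborel f * norm_L2 lborel (\<lambda>t. f (t - r n) - f t)) \<longlonglongrightarrow> norm_L2 lborel f * 0"
      using sq_integrable_translation_continuous[OF f2] r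
      by (intro tendsto_intros) (auto simp: translation_continuous_def)
    have bd: "cmod (A (r n) - A 0) \<le> norm_L2 lborel f * norm_L2 lborel (\<lambda>t. f (t - r n) - f t)" for n
    proof -
      have "A (r n) - A 0 = (LINT t|lborel. f t * cnj (f (t - r n) - f t))"
        unfolding A_def
        using sq_integrable_mult_cnj_integrable[OF f2 sq_integrable_translate[OF f2, of "r n"]]
          sq_integrable_mult_cnj_integrable[OF f2 f2]
        by (simp add: algebra_simps)
      then show ?thesis
        using cmod_integral_mult_cnj_le[OF f2 sq_integrable_diff[OF sq_integrable_translate[OF f2, of "r n"] f2]]
        by simp
    qed
    have "(\<lambda>n. A (r n) - A 0) \<longlonglongrightarrow> 0"
      by (rule Lim_null_comparison[OF always_eventually[OF allI[OF bd]]]) (use lim0 in simp)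
    then show ?thesis using LIM_zero_iff by blast
  qed
  have "(\<lambda>n. LINT x|lborel. complex_of_real (std_normal_density x) * A (d n * x))
    \<longlonglongrightarrow> (LINT x|lborel. complex_of_real (std_normal_density x) * A 0)"
  proof (rule integral_dominated_convergence[where w = "\<lambda>x. std_normal_density x * (norm_L2 lborel f)\<^sup>2"])
    show "AE x in lborel. (\<lambda>n. complex_of_real (std_normal_density x) * A (d n * x)) \<longlonglongrightarrow> complex_of_real (std_normal_density x) * A 0"
      by (intro AE_I2 tendsto_intros Alim) (use tendsto_mult_left_zero[OF dlim] in simp)
  qed (auto simp: norm_mult abs_mult intro!: mult_left_mono Ab)
  also have "(LINT x|lborel. complex_of_real (std_normal_density x) * A 0) = A 0"
    using integral_std_normal_chr[of 0] by simp
  finally have "(\<lambda>n. LINT y|lborel. gweight (d n) y * (cmod (ft f y))\<^sup>2) \<longlonglongrightarrow> Re (A 0)"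
    unfolding integral_gweight_ft[OF f f2 d] A_def by (rule tendsto_Re)
  then have lim: "(\<lambda>n. LINT y|lborel. gweight (d n) y * (cmod (ft f y))\<^sup>2) \<longlonglongrightarrow> (LINT t|lborel. (cmod (f t))\<^sup>2)"
    by (simp add: A0)
  have int: "integrable lborel (\<lambda>y. gweight (d n) y * (cmod (ft f y))\<^sup>2)" for n
  proof (rule Bochner_Integration.integrable_bound)
    show "integrable lborel (\<lambda>y. gweight (d n) y * (LINT t|lborel. cmod (f t))\<^sup>2)"
      using integrable_gweight[OF d] by simp
    show "AE y in lborel. norm (gweight (d n) y * (cmod (ft f y))\<^sup>2) \<le> norm (gweight (d n) y * (LINT t|lborel. cmod (f t))\<^sup>2)"
      using gweight_pos[of "d n"]
      by (auto simp: abs_mult intro!: mult_left_mono power_mono cmod_ft_le)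
  qed measurable
  have mono: "incseq (\<lambda>n. gweight (d n) y * (cmod (ft f y))\<^sup>2)" for y
  proof (rule incseq_SucI, rule mult_right_mono)
    fix n
    have "(2 * pi * d (Suc n) * y)\<^sup>2 \<le> (2 * pi * d n * y)\<^sup>2"
      by (auto simp: power_mult_distrib d_def intro!: mult_right_mono mult_left_mono power_mono le_imp_inverse_le)
    then show "gweight (d n) y \<le> gweight (d (Suc n)) y" by (simp add: gweight_def)
  qed simp
  have pt: "(\<lambda>n. gweight (d n) y * (cmod (ft f y))\<^sup>2) \<longlonglongrightarrow> (cmod (ft f y))\<^sup>2" for y
  proof -
    have "(\<lambda>n. gweight (d n) y * (cmod (ft f y))\<^sup>2) \<longlonglongrightarrow> exp (- (2 * pi * 0 * y)\<^sup>2 / 2) * (cmod (ft f y))\<^sup>2"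
      unfolding gweight_def by (intro tendsto_intros dlim) simp
    then show ?thesis by simp
  qed
  \<comment> \<open>Monotone convergence yields the integrability of the limit together with its
    integral.\<close>
  show ?thesis
    by (rule has_bochner_integral_monotone_convergence[OF int _ _ lim]) (use mono pt in \<open>auto simp: mono_def incseq_def\<close>)
qed

section \<open>Orthogonality relations for the short-time Fourier transform\<close>

text \<open>Polarisation: Plancherel's identity is applied to \<open>f + c * h\<close> for the four
  fourth roots of unity \<open>c\<close>.\<close>

lemma Plancherel_inner:
  assumes f: "integrable lborel f" "sq_integrable lborel f"
    and h: "integrable lborel h" "sq_integrable lborel h"
  shows "(LINT y|lborel. ft f y * cnj (ft h y)) = (LINT t|lborel. f t * cnj (h t))"
proof -
  have pol: "z * cnj w = (1 / 4) * (complex_of_real ((cmod (z + 1 * w))\<^sup>2) - complex_of_real ((cmod (z + (-1) * w))\<^sup>2)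
    + \<i> * complex_of_real ((cmod (z + \<i> * w))\<^sup>2) - \<i> * complex_of_real ((cmod (z + (-\<i>) * w))\<^sup>2))" for z w
    unfolding complex_norm_square by (simp add: complex_eq_iff) (simp add: algebra_simps)
  have P: "has_bochner_integral lborel (\<lambda>y. complex_of_real ((cmod (ft f y + c * ft h y))\<^sup>2))
    (complex_of_real (LINT t|lborel. (cmod (f t + c * h t))\<^sup>2))"
    and I: "integrable lborel (\<lambda>t. complex_of_real ((cmod (f t + c * h t))\<^sup>2))" for c
  proof -
    have s: "sq_integrable lborel (\<lambda>t. f t + c * h t)"
      by (intro sq_integrable_add sq_integrable_cmult f h)
    have i: "integrable lborel (\<lambda>t. f t + c * h t)" using f h by simp
    have ft_lin: "ft (\<lambda>t. f t + c * h t) y = ft f y + c * ft h y" for y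
      using ft_integrable[OF f(1), of y] ft_integrable[OF h(1), of y]
      by (simp add: ft_def algebra_simps)
    have "has_bochner_integral lborel (\<lambda>y. complex_of_real ((cmod (ft (\<lambda>t. f t + c * h t) y))\<^sup>2))
      (complex_of_real (LINT t|lborel. (cmod (f t + c * h t))\<^sup>2))"
      by (rule has_bochner_integral_of_real[OF Plancherel[OF i s]])
    then show "has_bochner_integral lborel (\<lambda>y. complex_of_real ((cmod (ft f y + c * ft h y))\<^sup>2))
      (complex_of_real (LINT t|lborel. (cmod (f t + c * h t))\<^sup>2))" by (simp only: ft_lin)
    show "integrable lborel (\<lambda>t. complex_of_real ((cmod (f t + c * h t))\<^sup>2))"
      using sq_integrable_norm_sq[OF s] by (rule integrable_of_real)
  qed
  define A where "A c y = complex_of_real ((cmod (ft f y + c * ft h y))\<^sup>2)" for c y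
  define B where "B c t = complex_of_real ((cmod (f t + c * h t))\<^sup>2)" for c t
  have A: "integrable lborel (A c)" and B: "integrable lborel (B c)"
    and AB: "integral\<^sup>L lborel (A c) = integral\<^sup>L lborel (B c)" for c
    using P[of c] I[of c] unfolding A_def[abs_def] B_def[abs_def] has_bochner_integral_iff
    by (simp_all only: integral_complex_of_real)
  have "(LINT y|lborel. ft f y * cnj (ft h y))
    = (LINT y|lborel. (1 / 4) * (A 1 y - A (- 1) y + \<i> * A \<i> y - \<i> * A (- \<i>) y))"
    unfolding A_def by (intro Bochner_Integration.integral_cong refl pol)
  also have "\<dots> = (LINT t|lborel. (1 / 4) * (B 1 t - B (- 1) t + \<i> * B \<i> t - \<i> * B (- \<i>) t))"
    by (simp add: A B AB)
  also have "\<dots> = (LINT t|lborel. f t * cnj (h t))"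
    unfolding B_def by (intro Bochner_Integration.integral_cong refl pol[symmetric])
  finally show ?thesis .
qed

section \<open>The short-time Fourier transform as an inner product and as a Fourier transform on
  slices\<close>

lemma L2_inner_bound:
  assumes "sq_integrable lborel f" "sq_integrable lborel h"
  shows "cmod (L2_inner f h) \<le> norm_L2 lborel f * norm_L2 lborel h"
  unfolding L2_inner_def by (rule cmod_integral_mult_cnj_le[OF assms])

lemma L2_inner_cnj: "cnj (L2_inner f h) = L2_inner h f"
  unfolding L2_inner_def by (simp add: mult.commute flip: Bochner_Integration.integral_cnj)

lemma stft_eq_ft: "stft g f p = ft (\<lambda>t. f t * cnj (g (t - fst p))) (snd p)"
  by (simp add: stft_def ft_def chr_def)

lemma tf_shift_chr: "tf_shift a b f t = chr (- (b * t)) * f (t - a)"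
  by (simp add: tf_shift_def chr_def)

lemma stft_eq_inner: "stft g f p = L2_inner f (tf_shift (fst p) (snd p) g)"
  by (simp add: stft_eq_ft ft_def L2_inner_def tf_shift_chr mult_ac)

lemma sq_integrable_tf_shift:
  assumes "sq_integrable lborel f"
  shows "sq_integrable lborel (tf_shift a b f)"
  unfolding tf_shift_chr[abs_def]
  by (intro sq_integrable_unimodular sq_integrable_translate assms) auto

lemma norm_L2_tf_shift: "norm_L2 lborel (tf_shift a b f) = norm_L2 lborel f"
  unfolding tf_shift_chr[abs_def] by (subst norm_L2_unimodular) (auto simp: norm_L2_translate)

lemma fst_measurable_borel [measurable]: "fst \<in> borel_measurable (borel :: (real \<times> real) measure)"
  by (intro borel_measurable_continuous_onI continuous_intros)

lemma snd_measurable_borel [measurable]: "snd \<in> borel_measurable (borel :: (real \<times> real) measure)"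
  by (intro borel_measurable_continuous_onI continuous_intros)

lemma stft_measurable [measurable]:
  assumes [measurable]: "f \<in> borel_measurable borel" "g \<in> borel_measurable borel"
  shows "stft g f \<in> borel_measurable borel"
  unfolding stft_eq_ft[abs_def] ft_def by measurable

lemma nn_integral_reflect_translate:
  assumes [measurable]: "w \<in> borel_measurable borel"
  shows "(\<integral>\<^sup>+x. w (t - x) \<partial>lborel) = (\<integral>\<^sup>+x. w x \<partial>(lborel :: real measure))"
  using nn_integral_real_affine[OF assms, of "-1" t] by simp

text \<open>By Tonelli the shift is integrated first; reflection and translation invariance turn
  that integral into the squared norm of \<open>g\<close>, whatever \<open>t\<close> is.\<close>

lemma nn_integral_correlation:
  fixes f g :: "real \<Rightarrow> complex"
  assumes f: "sq_integrable lborel f" and g: "sq_integrable lborel g"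
  shows "(\<integral>\<^sup>+x. \<integral>\<^sup>+t. ennreal ((cmod (f t * cnj (g (t - x))))\<^sup>2) \<partial>lborel \<partial>lborel)
    = ennreal ((norm_L2 lborel f)\<^sup>2 * (norm_L2 lborel g)\<^sup>2)"
proof -
  note [measurable] = sq_integrable_measurable[OF f] sq_integrable_measurable[OF g]
  have F: "(\<integral>\<^sup>+t. ennreal ((cmod (f t))\<^sup>2) \<partial>lborel) = ennreal ((norm_L2 lborel f)\<^sup>2)"
    using nn_integral_eq_integral[OF sq_integrable_norm_sq[OF f]] by (simp add: norm_L2_sq)
  have G: "(\<integral>\<^sup>+t. ennreal ((cmod (g t))\<^sup>2) \<partial>lborel) = ennreal ((norm_L2 lborel g)\<^sup>2)"
    using nn_integral_eq_integral[OF sq_integrable_norm_sq[OF g]] by (simp add: norm_L2_sq)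
  have "(\<integral>\<^sup>+x. \<integral>\<^sup>+t. ennreal ((cmod (f t * cnj (g (t - x))))\<^sup>2) \<partial>lborel \<partial>lborel)
    = (\<integral>\<^sup>+t. \<integral>\<^sup>+x. ennreal ((cmod (f t * cnj (g (t - x))))\<^sup>2) \<partial>lborel \<partial>lborel)"
    by (rule lborel_pair.Fubini') measurable
  also have "\<dots> = (\<integral>\<^sup>+t. ennreal ((cmod (f t))\<^sup>2) * (\<integral>\<^sup>+x. ennreal ((cmod (g (t - x)))\<^sup>2) \<partial>lborel) \<partial>lborel)"
    by (simp add: norm_mult power_mult_distrib ennreal_mult nn_integral_cmult)
  also have "\<dots> = (\<integral>\<^sup>+t. ennreal ((cmod (f t))\<^sup>2) * ennreal ((norm_L2 lborel g)\<^sup>2) \<partial>lborel)"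
    by (subst nn_integral_reflect_translate[where w = "\<lambda>x. ennreal ((cmod (g x))\<^sup>2)"]) (auto simp: G)
  also have "\<dots> = ennreal ((norm_L2 lborel f)\<^sup>2 * (norm_L2 lborel g)\<^sup>2)"
    by (simp add: nn_integral_multc F ennreal_mult)
  finally show ?thesis .
qed

text \<open>A finite double integral has almost all inner integrals finite. Plancherel on a slice
  needs this as well as integrability, which holds for every \<open>x\<close>.\<close>

lemma AE_sq_integrable_correlation:
  fixes f g :: "real \<Rightarrow> complex"
  assumes f: "sq_integrable lborel f" and g: "sq_integrable lborel g"
  shows "AE x in lborel. sq_integrable lborel (\<lambda>t. f t * cnj (g (t - x)))"
proof -
  note [measurable] = sq_integrable_measurable[OF f] sq_integrable_measurable[OF g]
  have "AE x in lborel. (\<integral>\<^sup>+t. ennreal ((cmod (f t * cnj (g (t - x))))\<^sup>2) \<partial>lborel) \<noteq> \<infinity>"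
    by (rule nn_integral_PInf_AE) (auto simp: nn_integral_correlation[OF f g])
  then show ?thesis
  proof eventually_elim
    case (elim x)
    then have "integrable lborel (\<lambda>t. (cmod (f t * cnj (g (t - x))))\<^sup>2)"
      by (intro integrableI_bounded) (auto simp: top.not_eq_extremum)
    then show ?case by (simp add: sq_integrable_def)
  qed
qed

lemma integrable_correlation:
  fixes f g :: "real \<Rightarrow> complex"
  assumes f: "sq_integrable lborel f" and g: "sq_integrable lborel g"
  shows "integrable lborel (\<lambda>t. f t * cnj (g (t - x)))"
  using sq_integrable_mult_cnj_integrable[OF f sq_integrable_translate[OF g]] .

text \<open>Plancherel on almost every slice of fixed first coordinate replaces the frequency
  integral by that of the correlation, whose total is finite.\<close>

lemma sq_integrable_stft:
  assumes f: "sq_integrable lborel f" and g: "sq_integrable lborel g"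
  shows "sq_integrable lborel (stft g f)"
proof -
  note [measurable] = sq_integrable_measurable[OF f] sq_integrable_measurable[OF g]
  have "(\<integral>\<^sup>+p. ennreal ((cmod (stft g f p))\<^sup>2) \<partial>lborel)
    = (\<integral>\<^sup>+x. \<integral>\<^sup>+y. ennreal ((cmod (stft g f (x, y)))\<^sup>2) \<partial>lborel \<partial>lborel)"
    by (subst lborel.nn_integral_fst) (auto simp: lborel_prod)
  also have "\<dots> = (\<integral>\<^sup>+x. \<integral>\<^sup>+t. ennreal ((cmod (f t * cnj (g (t - x))))\<^sup>2) \<partial>lborel \<partial>lborel)"
  proof (rule nn_integral_cong_AE)
    show "AE x in lborel. (\<integral>\<^sup>+y. ennreal ((cmod (stft g f (x, y)))\<^sup>2) \<partial>lborel)
      = (\<integral>\<^sup>+t. ennreal ((cmod (f t * cnj (g (t - x))))\<^sup>2) \<partial>lborel)"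
      using AE_sq_integrable_correlation[OF f g]
    proof eventually_elim
      case (elim x)
      note P = has_bochner_integral_iff[THEN iffD1, OF Plancherel[OF integrable_correlation[OF f g] elim]]
      show ?case
        using P nn_integral_eq_integral[of lborel "\<lambda>y. (cmod (stft g f (x, y)))\<^sup>2"]
          nn_integral_eq_integral[OF sq_integrable_norm_sq[OF elim]]
        by (simp add: stft_eq_ft)
    qed
  qed
  also have "\<dots> < \<infinity>"
    by (simp add: nn_integral_correlation[OF f g])
  finally show ?thesis
    by (auto simp: sq_integrable_def intro!: integrableI_bounded)
qed

text \<open>Polarised Plancherel on slices removes the frequency. After Fubini the shift occurs only
  in the windows, and its integral is a constant by reflection and translation.\<close>

theorem stft_orthogonality:
  assumes f1: "sq_integrable lborel f1" and f2: "sq_integrable lborel f2"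
    and g1: "sq_integrable lborel g1" and g2: "sq_integrable lborel g2"
  shows "has_bochner_integral lborel (\<lambda>p. stft g1 f1 p * cnj (stft g2 f2 p))
    (L2_inner f1 f2 * cnj (L2_inner g1 g2))"
proof -
  note [measurable] = sq_integrable_measurable[OF f1] sq_integrable_measurable[OF f2]
    sq_integrable_measurable[OF g1] sq_integrable_measurable[OF g2]
  have i: "integrable lborel (\<lambda>p. stft g1 f1 p * cnj (stft g2 f2 p))"
    by (intro sq_integrable_mult_cnj_integrable sq_integrable_stft assms)
  let ?F = "\<lambda>t x. (f1 t * cnj (f2 t)) * cnj (g1 (t - x) * cnj (g2 (t - x)))"
  have "(LINT p|lborel. stft g1 f1 p * cnj (stft g2 f2 p))
    = (LINT x|lborel. LINT y|lborel. stft g1 f1 (x, y) * cnj (stft g2 f2 (x, y)))"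
    using lborel_pair.integral_fst'[of "\<lambda>p. stft g1 f1 p * cnj (stft g2 f2 p)"] i by (simp add: lborel_prod)
  also have "\<dots> = (LINT x|lborel. LINT t|lborel. ?F t x)"
  proof (rule integral_cong_AE)
    show "AE x in lborel. (LINT y|lborel. stft g1 f1 (x, y) * cnj (stft g2 f2 (x, y))) = (LINT t|lborel. ?F t x)"
      using AE_sq_integrable_correlation[OF f1 g1] AE_sq_integrable_correlation[OF f2 g2]
    proof eventually_elim
      case (elim x)
      then show ?case
        using Plancherel_inner[OF integrable_correlation[OF f1 g1] elim(1) integrable_correlation[OF f2 g2] elim(2)]
        by (simp add: stft_eq_ft mult_ac)
    qed
  qed measurable
  also have "\<dots> = (LINT t|lborel. LINT x|lborel. ?F t x)"
  proof (rule Fubini_swap[symmetric], rule lborel_pair.Fubini_integrable)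
    \<comment> \<open>The reflection of \<open>x\<close> about \<open>t\<close> makes the inner
      integral independent of \<open>t\<close>, so integrability of \<open>f1 * cnj f2\<close> is
      all that remains for Fubini.\<close>
    have refl: "(LINT x|lborel. cmod (g1 (t - x) * cnj (g2 (t - x)))) = (LINT x|lborel. cmod (g1 x * cnj (g2 x)))" for t
      using lborel_integral_real_affine[of "-1" "\<lambda>x. cmod (g1 x * cnj (g2 x))" t] by simp
    show "(\<lambda>(t, x). ?F t x) \<in> borel_measurable (lborel \<Otimes>\<^sub>M lborel)" by measurable
    have "integrable lborel (\<lambda>t. cmod (f1 t * cnj (f2 t)) * (LINT x|lborel. cmod (g1 x * cnj (g2 x))))"
      using sq_integrable_mult_cnj_integrable[OF f1 f2] by (intro integrable_mult_left integrable_norm)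
    then show "integrable lborel (\<lambda>t. LINT x|lborel. norm (case (t, x) of (t, x) \<Rightarrow> ?F t x))"
      using refl by (simp add: norm_mult)
    show "AE t in lborel. integrable lborel (\<lambda>x. case (t, x) of (t, x) \<Rightarrow> ?F t x)"
    proof (rule AE_I2)
      fix t
      have "integrable lborel (\<lambda>x. g1 (t + (-1) * x) * cnj (g2 (t + (-1) * x)))"
        by (rule lborel_integrable_real_affine[OF sq_integrable_mult_cnj_integrable[OF g1 g2]]) simp
      then have "integrable lborel (\<lambda>x. cnj (g1 (t + (-1) * x) * cnj (g2 (t + (-1) * x))))"
        by (rule integrable_cnj)
      then have "integrable lborel (\<lambda>x. cnj (g1 (t - x) * cnj (g2 (t - x))))"
        by (simp only: mult_minus1 add_uminus_conv_diff)
      then show "integrable lborel (\<lambda>x. case (t, x) of (t, x) \<Rightarrow> ?F t x)"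
        unfolding prod.case by (rule integrable_mult_right)
    qed
  qed
  also have "\<dots> = (LINT t|lborel. (f1 t * cnj (f2 t)) * cnj (L2_inner g1 g2))"
  proof (intro Bochner_Integration.integral_cong refl)
    fix t
    have "(LINT x|lborel. g1 x * cnj (g2 x)) = (LINT x|lborel. g1 (t - x) * cnj (g2 (t - x)))"
      using lborel_integral_real_affine[of "-1" "\<lambda>x. g1 x * cnj (g2 x)" t] by simp
    then show "(LINT x|lborel. ?F t x) = (f1 t * cnj (f2 t)) * cnj (L2_inner g1 g2)"
      unfolding L2_inner_def by (simp only: integral_mult_right_zero Bochner_Integration.integral_cnj)
  qed
  also have "\<dots> = L2_inner f1 f2 * cnj (L2_inner g1 g2)"
    by (simp add: L2_inner_def)
  finally show ?thesis using i by (simp add: has_bochner_integral_iff)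
qed

section \<open>Rotation of the plane and multiplication by characters\<close>

lemma integrable_prod_swap:
  fixes G :: "real \<times> real \<Rightarrow> complex"
  assumes "integrable lborel G"
  shows "integrable lborel (\<lambda>p. G (snd p, fst p))"
  using lborel_pair.integrable_product_swap[of G] assms by (simp add: lborel_prod case_prod_beta')

lemma stft_reflect: "stft g f (x, - y) = cnj (stft (\<lambda>t. cnj (g t)) (\<lambda>t. cnj (f t)) (x, y))"
  by (simp add: stft_eq_ft ft_def flip: Bochner_Integration.integral_cnj)

text \<open>The quarter turn is a coordinate swap, which preserves integrability, combined with a
  sign change of the frequency, which \<open>stft_reflect\<close> absorbs by conjugating functions
  and windows.\<close>

lemma integrable_stft_rotated:
  assumes "sq_integrable lborel f1" "sq_integrable lborel f2" "sq_integrable lborel g1" "sq_integrable lborel g2"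
  shows "integrable lborel (\<lambda>p. stft g1 f1 (snd p, - fst p) * cnj (stft g2 f2 (snd p, - fst p)))"
proof -
  have "integrable lborel (\<lambda>p. cnj (stft (\<lambda>t. cnj (g1 t)) (\<lambda>t. cnj (f1 t)) p * cnj (stft (\<lambda>t. cnj (g2 t)) (\<lambda>t. cnj (f2 t)) p)))"
    by (intro integrable_cnj sq_integrable_mult_cnj_integrable sq_integrable_stft sq_integrable_cnj assms)
  from integrable_prod_swap[OF this] show ?thesis
    by (simp add: stft_reflect)
qed

text \<open>The character is the phase by which the time-frequency shifts at \<open>(a, b)\<close>
  and \<open>(\<eta>, - \<xi>)\<close> fail to commute; shifting the function and the window
  together leaves only this phase.\<close>

lemma stft_chr:
  "chr (a * \<xi> + b * \<eta>) * stft g f (a, b) = stft (tf_shift \<eta> (- \<xi>) g) (tf_shift \<eta> (- \<xi>) f) (a, b)"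
proof -
  let ?k = "\<lambda>t. f t * cnj (g (t - a)) * chr (b * t)"
  have "stft (tf_shift \<eta> (- \<xi>) g) (tf_shift \<eta> (- \<xi>) f) (a, b)
    = (LINT t|lborel. chr (a * \<xi> + b * \<eta>) * ?k (t - \<eta>))"
    unfolding stft_eq_ft ft_def fst_conv snd_conv
  proof (intro Bochner_Integration.integral_cong refl)
    fix t
    have "chr (\<xi> * t) * cnj (chr (\<xi> * (t - a))) * chr (b * t) = chr (a * \<xi> + b * \<eta>) * chr (b * (t - \<eta>))"
      unfolding cnj_chr chr_add[symmetric] by (simp add: algebra_simps)
    then show "tf_shift \<eta> (- \<xi>) f t * cnj (tf_shift \<eta> (- \<xi>) g (t - a)) * chr (b * t)
      = chr (a * \<xi> + b * \<eta>) * ?k (t - \<eta>)"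
      by (simp add: tf_shift_chr algebra_simps)
  qed
  also have "\<dots> = chr (a * \<xi> + b * \<eta>) * (LINT t|lborel. ?k t)"
    using integral_translate[of ?k \<eta>] by simp
  finally show ?thesis by (simp add: stft_eq_ft ft_def)
qed

section \<open>Uniform continuity, decay and strict positive definiteness\<close>

lemma norm_L2_diff_le:
  assumes "sq_integrable M f" "sq_integrable M h"
  shows "norm_L2 M (\<lambda>x. f x - h x) \<le> norm_L2 M f + norm_L2 M h"
  using norm_L2_add_le[OF assms(1) sq_integrable_cmult[OF assms(2), of "-1"]] norm_L2_cmult[of M "-1" h]
  by simp

text \<open>The mean-square modulus of continuity of time-frequency shifts at \<open>g\<close>, as a
  function of the offset.\<close>

definition tf_modulus :: "(real \<Rightarrow> complex) \<Rightarrow> real \<times> real \<Rightarrow> real" where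
  "tf_modulus g r = norm_L2 lborel (\<lambda>t. g t - tf_shift (fst r) (snd r) g t)"

text \<open>Modulation and translation are treated separately: the first by dominated convergence
  with bound \<open>4 * (cmod (g t))\<^sup>2\<close>, the second by continuity of
  translation.\<close>

lemma tf_modulus_tendsto_0:
  assumes g: "sq_integrable lborel g" and r: "r \<longlonglongrightarrow> 0"
  shows "(\<lambda>n. tf_modulus g (r n)) \<longlonglongrightarrow> 0"
proof -
  note [measurable] = sq_integrable_measurable[OF g]
  have r1: "(\<lambda>n. fst (r n)) \<longlonglongrightarrow> 0" and r2: "(\<lambda>n. snd (r n)) \<longlonglongrightarrow> 0"
    using tendsto_fst[OF r] tendsto_snd[OF r] by simp_all
  let ?c = "\<lambda>n t. chr (- (snd (r n) * t))"
  have "(\<lambda>n. norm_L2 lborel (\<lambda>t. (1 - ?c n t) * g t)) \<longlonglongrightarrow> 0"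
  proof (rule norm_L2_tendsto_0)
    show "integrable lborel (\<lambda>t. 2\<^sup>2 * (cmod (g t))\<^sup>2)"
      using sq_integrable_norm_sq[OF g] by simp
    show "AE t in lborel. (\<lambda>n. (1 - ?c n t) * g t) \<longlonglongrightarrow> 0"
    proof (rule AE_I2)
      fix t
      have "(\<lambda>n. (1 - ?c n t) * g t) \<longlonglongrightarrow> (1 - chr (- (0 * t))) * g t"
        by (intro tendsto_intros r2)
      then show "(\<lambda>n. (1 - ?c n t) * g t) \<longlonglongrightarrow> 0" by simp
    qed
    fix n t
    have "cmod (1 - ?c n t) \<le> 2"
      using norm_triangle_ineq4[of 1 "?c n t"] by simp
    then have "(cmod (1 - ?c n t))\<^sup>2 \<le> 2\<^sup>2" by (intro power_mono) auto
    then show "(cmod ((1 - ?c n t) * g t))\<^sup>2 \<le> 2\<^sup>2 * (cmod (g t))\<^sup>2"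
      unfolding norm_mult power_mult_distrib by (rule mult_right_mono) simp
  qed measurable
  moreover have "(\<lambda>n. norm_L2 lborel (\<lambda>t. g (t - fst (r n)) - g t)) \<longlonglongrightarrow> 0"
    using sq_integrable_translation_continuous[OF g] r1 by (auto simp: translation_continuous_def)
  ultimately have lim: "(\<lambda>n. norm_L2 lborel (\<lambda>t. (1 - ?c n t) * g t) + norm_L2 lborel (\<lambda>t. g (t - fst (r n)) - g t)) \<longlonglongrightarrow> 0"
    using tendsto_add by fastforce
  have bd: "tf_modulus g (r n) \<le> norm_L2 lborel (\<lambda>t. (1 - ?c n t) * g t) + norm_L2 lborel (\<lambda>t. g (t - fst (r n)) - g t)" for n
  proof -
    have s1: "sq_integrable lborel (\<lambda>t. g t - ?c n t * g t)"
      by (intro sq_integrable_diff sq_integrable_unimodular g) auto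
    have s2: "sq_integrable lborel (\<lambda>t. g (t - fst (r n)) - g t)"
      by (intro sq_integrable_diff sq_integrable_translate g)
    have s3: "sq_integrable lborel (\<lambda>t. ?c n t * (g (t - fst (r n)) - g t))"
      by (intro sq_integrable_unimodular s2) auto
    have "tf_modulus g (r n) = norm_L2 lborel (\<lambda>t. (g t - ?c n t * g t) - ?c n t * (g (t - fst (r n)) - g t))"
      by (simp add: tf_modulus_def tf_shift_chr algebra_simps)
    also have "\<dots> \<le> norm_L2 lborel (\<lambda>t. g t - ?c n t * g t) + norm_L2 lborel (\<lambda>t. ?c n t * (g (t - fst (r n)) - g t))"
      by (rule norm_L2_diff_le[OF s1 s3])
    also have "norm_L2 lborel (\<lambda>t. ?c n t * (g (t - fst (r n)) - g t)) = norm_L2 lborel (\<lambda>t. g (t - fst (r n)) - g t)"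
      by (rule norm_L2_unimodular) simp
    finally show ?thesis by (simp add: algebra_simps)
  qed
  show ?thesis
    by (rule Lim_null_comparison[OF always_eventually lim]) (use bd in \<open>auto simp: tf_modulus_def\<close>)
qed

text \<open>The product does not change when the time-frequency shift of \<open>g\<close> is multiplied by a
  phase, and up to such a phase two shifts differ by \<open>tf_modulus\<close> of their offset.\<close>

lemma stft_product_modulus:
  assumes f: "sq_integrable lborel f" and h: "sq_integrable lborel h" and g: "sq_integrable lborel g"
  shows "cmod (stft g f p * cnj (stft g h p) - stft g f q * cnj (stft g h q))
    \<le> 2 * norm_L2 lborel f * norm_L2 lborel h * norm_L2 lborel g * tf_modulus g (q - p)"
proof -
  obtain a b where p: "p = (a, b)" by (cases p)
  obtain a' b' where q: "q = (a', b')" by (cases q)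
  \<comment> \<open>With this phase \<open>v\<close> is the shift by \<open>p\<close> of the shift
    by \<open>q - p\<close> of \<open>g\<close>, so the shift by \<open>p\<close> factors out of
    \<open>u - v\<close> and, being an isometry, drops out of the norm.\<close>
  define c where "c = chr ((b' - b) * a)"
  define u where "u = tf_shift a b g"
  define v where "v t = c * tf_shift a' b' g t" for t
  have su: "sq_integrable lborel u" and nu: "norm_L2 lborel u = norm_L2 lborel g"
    by (auto simp: u_def sq_integrable_tf_shift g norm_L2_tf_shift)
  have sv: "sq_integrable lborel v" and nv: "norm_L2 lborel v = norm_L2 lborel g"
    unfolding v_def[abs_def] by (auto simp: sq_integrable_tf_shift g norm_L2_tf_shift sq_integrable_cmult norm_L2_cmult c_def)
  have suv: "sq_integrable lborel (\<lambda>t. u t - v t)" by (intro sq_integrable_diff su sv)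
  have nuv: "norm_L2 lborel (\<lambda>t. u t - v t) = tf_modulus g (q - p)"
  proof -
    have "u t - v t = chr (- (b * t)) * (g (t - a) - tf_shift (a' - a) (b' - b) g (t - a))" for t
    proof -
      have "chr ((b' - b) * a) * chr (- (b' * t)) = chr (- (b * t)) * chr (- ((b' - b) * (t - a)))"
        unfolding chr_add[symmetric] by (simp add: algebra_simps)
      then show ?thesis
        by (simp add: u_def v_def c_def tf_shift_chr algebra_simps)
    qed
    then have "norm_L2 lborel (\<lambda>t. u t - v t)
      = norm_L2 lborel (\<lambda>t. g (t - a) - tf_shift (a' - a) (b' - b) g (t - a))"
      by (simp add: norm_L2_unimodular)
    also have "\<dots> = tf_modulus g (q - p)"
      using norm_L2_translate[of "\<lambda>t. g t - tf_shift (a' - a) (b' - b) g t" a]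
      by (simp add: tf_modulus_def p q)
    finally show ?thesis .
  qed
  have inner_v: "L2_inner k v = cnj c * stft g k q" for k
    by (simp add: stft_eq_inner L2_inner_def v_def q mult_ac)
  have inner_diff: "L2_inner k (\<lambda>t. u t - v t) = L2_inner k u - L2_inner k v" if k: "sq_integrable lborel k" for k
    using sq_integrable_mult_cnj_integrable[OF k su] sq_integrable_mult_cnj_integrable[OF k sv]
    by (simp add: L2_inner_def algebra_simps)
  have "cnj c * c = 1" by (simp add: c_def)
  then have "stft g f q * cnj (stft g h q) = L2_inner f v * cnj (L2_inner h v)"
    unfolding inner_v by (simp add: mult_ac)
  moreover have "stft g f p * cnj (stft g h p) = L2_inner f u * cnj (L2_inner h u)"
    by (simp add: stft_eq_inner u_def p)
  \<comment> \<open>The splitting \<open>x * y - x' * y' = (x - x') * y + x' * (y - y')\<close>,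
    which puts \<open>u - v\<close> into one inner product of each term.\<close>
  ultimately have "stft g f p * cnj (stft g h p) - stft g f q * cnj (stft g h q)
    = L2_inner f (\<lambda>t. u t - v t) * cnj (L2_inner h u) + L2_inner f v * cnj (L2_inner h (\<lambda>t. u t - v t))"
    by (simp add: inner_diff f h algebra_simps)
  then have "cmod (stft g f p * cnj (stft g h p) - stft g f q * cnj (stft g h q))
    \<le> cmod (L2_inner f (\<lambda>t. u t - v t) * cnj (L2_inner h u))
      + cmod (L2_inner f v * cnj (L2_inner h (\<lambda>t. u t - v t)))"
    by (simp only: norm_triangle_ineq)
  also have "\<dots> = cmod (L2_inner f (\<lambda>t. u t - v t)) * cmod (L2_inner h u)
      + cmod (L2_inner f v) * cmod (L2_inner h (\<lambda>t. u t - v t))"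
    by (simp only: norm_mult complex_mod_cnj)
  also have "\<dots> \<le> (norm_L2 lborel f * tf_modulus g (q - p)) * (norm_L2 lborel h * norm_L2 lborel g)
      + (norm_L2 lborel f * norm_L2 lborel g) * (norm_L2 lborel h * tf_modulus g (q - p))"
    using L2_inner_bound[OF f suv] L2_inner_bound[OF h su] L2_inner_bound[OF f sv] L2_inner_bound[OF h suv]
    unfolding nu nv nuv
    by (intro add_mono mult_mono mult_nonneg_nonneg norm_ge_zero norm_L2_nonneg) (simp_all add: tf_modulus_def)
  finally show ?thesis by (simp add: algebra_simps)
qed

lemma uniformly_continuous_stft_product:
  assumes f: "sq_integrable lborel f" and h: "sq_integrable lborel h" and g: "sq_integrable lborel g"
  shows "uniformly_continuous_on UNIV (\<lambda>p. stft g f p * cnj (stft g h p))"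
  unfolding uniformly_continuous_on_sequentially
proof (intro allI impI, elim conjE)
  fix x y :: "nat \<Rightarrow> real \<times> real"
  assume "(\<lambda>n. dist (x n) (y n)) \<longlonglongrightarrow> 0"
  then have "(\<lambda>n. norm (y n - x n)) \<longlonglongrightarrow> 0" by (simp add: dist_norm norm_minus_commute)
  then have "(\<lambda>n. y n - x n) \<longlonglongrightarrow> 0" by (rule tendsto_norm_zero_cancel)
  from tendsto_mult_right_zero[OF tf_modulus_tendsto_0[OF g this], of "2 * norm_L2 lborel f * norm_L2 lborel h * norm_L2 lborel g"]
  have lim: "(\<lambda>n. 2 * norm_L2 lborel f * norm_L2 lborel h * norm_L2 lborel g * tf_modulus g (y n - x n)) \<longlonglongrightarrow> 0" .
  show "(\<lambda>n. dist (stft g f (x n) * cnj (stft g h (x n))) (stft g f (y n) * cnj (stft g h (y n)))) \<longlonglongrightarrow> 0"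
    by (rule Lim_null_comparison[OF always_eventually lim])
      (use stft_product_modulus[OF f h g] in \<open>auto simp: dist_norm\<close>)
qed

text \<open>A value of at least \<open>e\<close> far out would keep \<open>F\<close> above
  \<open>e / 2\<close> on a ball of fixed radius, whose contribution exceeds the tail of a
  convergent integral.\<close>

lemma uniformly_continuous_integrable_tendsto_0:
  fixes F :: "'a::euclidean_space \<Rightarrow> real"
  assumes uc: "uniformly_continuous_on UNIV F" and i: "integrable lborel F" and nn: "\<And>p. 0 \<le> F p"
  shows "(F \<longlongrightarrow> 0) at_infinity"
proof (rule tendstoI)
  note [measurable] = borel_measurable_integrable[OF i]
  fix e :: real assume e: "0 < e"
  obtain d where d: "0 < d" "\<And>p q. dist q p < d \<Longrightarrow> dist (F q) (F p) < e / 2"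
    using uc e unfolding uniformly_continuous_on_def by (metis UNIV_I half_gt_zero)
  define V where "V = unit_ball_vol (real DIM('a)) * d ^ DIM('a)"
  have V: "0 < V" using d by (simp add: V_def)
  have mV: "measure lborel (ball p d) = V" for p :: 'a
    using content_ball[of d p] d by (simp add: V_def)
  have "(\<lambda>n. LINT p|lborel. F p * indicator {p. real n \<le> norm p} p) \<longlonglongrightarrow> (LINT p::'a|lborel. 0)"
  proof (rule integral_dominated_convergence[where w = F])
    show "AE p in lborel. (\<lambda>n. F p * indicator {p. real n \<le> norm p} p) \<longlonglongrightarrow> 0"
    proof (rule AE_I2)
      fix p :: 'a
      obtain m where m: "norm p < real m" using reals_Archimedean2 by blast
      have "eventually (\<lambda>n. F p * indicator {p. real n \<le> norm p} p = 0) sequentially"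
        using eventually_ge_at_top[of m] by eventually_elim (use m in \<open>auto simp: indicator_def\<close>)
      then show "(\<lambda>n. F p * indicator {p. real n \<le> norm p} p) \<longlonglongrightarrow> 0" by (rule tendsto_eventually)
    qed
    show "AE p in lborel. norm (F p * indicator {p. real n \<le> norm p} p) \<le> F p" for n
      using nn by (auto simp: indicator_def)
  qed (use i in auto)
  then have "eventually (\<lambda>n. (LINT p|lborel. F p * indicator {p. real n \<le> norm p} p) < e / 2 * V) sequentially"
    using V e by (intro order_tendstoD(2)[of _ "LINT p::'a|lborel. 0"]) auto
  then obtain n where n: "(LINT p|lborel. F p * indicator {p. real n \<le> norm p} p) < e / 2 * V"
    by (auto simp: eventually_sequentially)
  \<comment> \<open>The margin \<open>d\<close> keeps the whole ball around \<open>p\<close> inside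
    the region over which the tail is taken.\<close>
  have "F p < e" if p: "real n + d \<le> norm p" for p
  proof (rule ccontr)
    assume "\<not> F p < e"
    have "e / 2 * V = (LINT q|lborel. e / 2 * indicator (ball p d) q)"
      by (simp add: mV)
    also have "\<dots> \<le> (LINT q|lborel. F q * indicator {p. real n \<le> norm p} q)"
    proof (rule integral_mono)
      show "integrable lborel (\<lambda>q. e / 2 * indicator (ball p d) q)"
        using emeasure_bounded_finite[OF bounded_ball, of p d]
        by (intro integrable_mult_right integrable_real_indicator) (auto simp: less_top)
      show "integrable lborel (\<lambda>q. F q * indicator {p. real n \<le> norm p} q)"
        by (rule Bochner_Integration.integrable_bound[OF i]) (auto simp: indicator_def)
      fix q
      show "e / 2 * indicator (ball p d) q \<le> F q * indicator {p. real n \<le> norm p} q"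
      proof (cases "q \<in> ball p d")
        case True
        then have "dist q p < d" by (simp add: dist_commute)
        then have "dist (F q) (F p) < e / 2" by (rule d(2))
        then have "e / 2 \<le> F q" using \<open>\<not> F p < e\<close> unfolding dist_real_def by linarith
        moreover have "real n \<le> norm q"
          using p \<open>dist q p < d\<close> norm_triangle_ineq2[of p q] by (simp add: dist_norm norm_minus_commute)
        ultimately show ?thesis using True by simp
      qed (use nn in \<open>auto simp: indicator_def\<close>)
    qed
    finally show False using n by simp
  qed
  then show "\<forall>\<^sub>F p in at_infinity. dist (F p) 0 < e"
    using nn unfolding eventually_at_infinity by (auto intro!: exI[of _ "real n + d"])
qed

section \<open>Fourier transforms on the plane and strict positive definiteness\<close>

lemma fourier2_chr: "fourier2 F q = (LINT p|lborel. F p * chr (fst p * fst q + snd p * snd q))"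
  by (simp add: fourier2_def chr_def)

lemma integrable_fourier2:
  assumes F: "integrable lborel F"
  shows "integrable lborel (\<lambda>p. F p * chr (fst p * fst q + snd p * snd q))"
  by (rule Bochner_Integration.integrable_bound[OF F]) (use borel_measurable_integrable[OF F] in \<open>auto simp: norm_mult\<close>)

lemma continuous_on_fourier2:
  assumes F: "integrable lborel F"
  shows "continuous_on UNIV (fourier2 F)"
  unfolding continuous_on_sequentially
proof (intro allI ballI impI, elim conjE)
  note [measurable] = borel_measurable_integrable[OF F]
  fix x :: "nat \<Rightarrow> real \<times> real" and q assume x: "x \<longlonglongrightarrow> q"
  have "(\<lambda>n. LINT p|lborel. F p * chr (fst p * fst (x n) + snd p * snd (x n)))
    \<longlonglongrightarrow> (LINT p|lborel. F p * chr (fst p * fst q + snd p * snd q))"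
  proof (rule integral_dominated_convergence[where w = "\<lambda>p. cmod (F p)"])
    show "AE p in lborel. (\<lambda>n. F p * chr (fst p * fst (x n) + snd p * snd (x n))) \<longlonglongrightarrow> F p * chr (fst p * fst q + snd p * snd q)"
      by (intro AE_I2 tendsto_intros x)
  qed (use F in \<open>auto simp: norm_mult\<close>)
  then show "(fourier2 F \<circ> x) \<longlonglongrightarrow> fourier2 F q"
    by (simp add: o_def fourier2_chr)
qed

text \<open>Comparing \<open>\<Sum>\<^sub>x c x e\<^sub>x(p + h)\<close> with \<open>e\<^sub>y(h) \<Sum>\<^sub>x c x e\<^sub>x(p)\<close> eliminates the
  frequency \<open>y\<close> and multiplies the other coefficients by factors that are non-zero for a suitable small \<open>h\<close>.\<close>

lemma trig_poly_vanishing_on_ball: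
  fixes S :: "(real \<times> real) set"
  assumes "finite S" "0 < r" "\<And>p. p \<in> ball p0 r \<Longrightarrow> (\<Sum>x\<in>S. c x * chr (fst p * fst x + snd p * snd x)) = 0"
    and "x \<in> S"
  shows "c x = 0"
  using assms
proof (induction S arbitrary: c r x rule: finite_induct)
  case (insert y S)
  let ?e = "\<lambda>x p. chr (fst p * fst x + snd p * snd x)"
  have e_add: "?e x (p + h) = ?e x p * ?e x h" for x p h :: "real \<times> real"
    by (simp add: chr_add[symmetric] algebra_simps)
  have other: "c z = 0" if z: "z \<in> S" for z
  proof -
    define w where "w = z - y"
    have w: "w \<noteq> 0" using insert.hyps z by (auto simp: w_def)
    define N where "N = (fst w)\<^sup>2 + (snd w)\<^sup>2"
    have N: "0 < N" using w by (auto simp: N_def prod_eq_iff sum_power2_gt_zero_iff)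
    \<comment> \<open>The first bound keeps \<open>2 * pi * (s * N)\<close> in
      \<open>(0, pi]\<close>, where the cosine is below \<open>1\<close>; the second gives
      \<open>norm h \<le> r / 2\<close>, so a shift by \<open>h\<close> from the half ball stays in
      the ball.\<close>
    define s where "s = min (1 / (2 * N)) (r / (2 * norm w))"
    have s: "0 < s" using N w insert.prems(1) by (simp add: s_def)
    define h where "h = s *\<^sub>R w"
    have sN: "s * N \<le> 1 / 2" using N by (simp add: s_def min_def field_simps)
    have "s * norm w \<le> r / (2 * norm w) * norm w" by (intro mult_right_mono) (auto simp: s_def)
    then have nh: "norm h \<le> r / 2" using s w by (simp add: h_def)
    have zero: "(\<Sum>x\<in>S. (c x * (?e x h - ?e y h)) * ?e x p) = 0" if p: "p \<in> ball p0 (r / 2)" for p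
    proof -
      have p1: "p \<in> ball p0 r" using p insert.prems(1) by auto
      have "dist p0 (p + h) \<le> dist p0 p + norm h"
        using dist_triangle[of p0 "p + h" p] by (simp add: dist_norm)
      then have p2: "p + h \<in> ball p0 r" using p nh by simp
      have "(\<Sum>x\<in>insert y S. c x * ?e x (p + h)) - ?e y h * (\<Sum>x\<in>insert y S. c x * ?e x p) = 0"
        using insert.prems(2)[OF p1] insert.prems(2)[OF p2] by simp
      moreover have "(\<Sum>x\<in>insert y S. c x * ?e x (p + h)) - ?e y h * (\<Sum>x\<in>insert y S. c x * ?e x p)
         = (\<Sum>x\<in>insert y S. (c x * (?e x h - ?e y h)) * ?e x p)"
        unfolding e_add sum_distrib_left sum_subtractf[symmetric]
        by (intro sum.cong refl) (simp add: algebra_simps)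
      ultimately show ?thesis using insert.hyps by simp
    qed
    have "c z * (?e z h - ?e y h) = 0"
      using insert.prems(1) zero z
      by (intro insert.IH[where r = "r / 2" and c = "\<lambda>x. c x * (?e x h - ?e y h)"]) auto
    moreover have "?e z h \<noteq> ?e y h"
    proof
      assume eq: "?e z h = ?e y h"
      have "fst h * fst z + snd h * snd z - (fst h * fst y + snd h * snd y) = s * N"
        by (simp add: h_def w_def N_def power2_eq_square algebra_simps)
      then have "chr (s * N) = ?e z h * chr (- (fst h * fst y + snd h * snd y))"
        using chr_diff by metis
      also have "\<dots> = 1" by (simp add: eq del: minus_add_distrib)
      finally have "cos (2 * pi * (s * N)) = 1"
        by (simp add: chr_cis complex_eq_iff)
      moreover have "cos (2 * pi * (s * N)) < cos 0"
        using s N sN by (intro cos_monotone_0_pi) (auto simp: field_simps)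
      ultimately show False by simp
    qed
    ultimately show ?thesis by simp
  qed
  \<comment> \<open>All other coefficients vanish, so the sum at the centre is the single term of
    \<open>y\<close>.\<close>
  have "c y * ?e y p0 = 0"
    using insert.prems(2)[of p0] insert.prems(1) insert.hyps other by simp
  then have "c y = 0" by (metis mult_eq_0_iff cmod_chr norm_zero zero_neq_one)
  with other insert.prems(3) show ?case by (metis insertE)
qed simp

text \<open>The quadratic form is the integral of \<open>F\<close> times the squared modulus of a
  trigonometric polynomial \<open>P\<close>. If it is zero, then \<open>P\<close> vanishes on a ball
  where \<open>F\<close> is positive, which forces zero coefficients.\<close>

lemma strictly_pos_def_fourier2:
  fixes F :: "real \<times> real \<Rightarrow> real"
  assumes i: "integrable lborel F" and nn: "\<And>p. 0 \<le> F p" and c: "continuous_on UNIV F" and p0: "0 < F p0"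
  shows "strictly_pos_def (fourier2 (\<lambda>p. complex_of_real (F p)))"
  unfolding strictly_pos_def_def Let_def
proof (intro conjI allI impI)
  have ic: "integrable lborel (\<lambda>p. complex_of_real (F p))" using i by simp
  show "continuous_on UNIV (fourier2 (\<lambda>p. complex_of_real (F p)))"
    by (rule continuous_on_fourier2[OF ic])
  fix M :: nat and x :: "nat \<Rightarrow> real \<times> real" and d :: "nat \<Rightarrow> complex"
  assume inj: "inj_on x {..<M}"
  let ?e = "\<lambda>x p. chr (fst p * fst x + snd p * snd x)"
  define P where "P p = (\<Sum>j<M. d j * ?e (x j) p)" for p
  define s where "s = (\<Sum>j<M. \<Sum>k<M. d j * cnj (d k) * fourier2 (\<lambda>p. complex_of_real (F p)) (x j - x k))"
  have int: "integrable lborel (\<lambda>p. d j * cnj (d k) * (complex_of_real (F p) * ?e (x j - x k) p))" for j k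
    by (intro integrable_mult_right integrable_fourier2 ic)
  have exp: "complex_of_real (F p * (cmod (P p))\<^sup>2)
     = (\<Sum>j<M. \<Sum>k<M. d j * cnj (d k) * (complex_of_real (F p) * ?e (x j - x k) p))" for p
  proof -
    have "?e (x j) p * cnj (?e (x k) p) = ?e (x j - x k) p" for j k
      unfolding cnj_chr chr_add[symmetric] by (simp add: algebra_simps)
    moreover have "d j * ?e (x j) p * cnj (d k * ?e (x k) p) = d j * cnj (d k) * (?e (x j) p * cnj (?e (x k) p))" for j k
      by (simp only: complex_cnj_mult mult_ac)
    ultimately have e: "d j * ?e (x j) p * cnj (d k * ?e (x k) p) = d j * cnj (d k) * ?e (x j - x k) p" for j k
      by (simp only:)
    have "complex_of_real (F p * (cmod (P p))\<^sup>2) = complex_of_real (F p) * (P p * cnj (P p))"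
      by (simp flip: complex_norm_square)
    also have "P p * cnj (P p) = (\<Sum>j<M. \<Sum>k<M. d j * cnj (d k) * ?e (x j - x k) p)"
      unfolding P_def cnj_sum sum_product e ..
    finally show ?thesis
      by (simp add: sum_distrib_left mult_ac)
  qed
  have h: "has_bochner_integral lborel (\<lambda>p. complex_of_real (F p * (cmod (P p))\<^sup>2)) s"
    unfolding exp s_def fourier2_chr
    by (intro has_bochner_integral_sum) (use int in \<open>auto simp: has_bochner_integral_iff\<close>)
  then have ih: "integrable lborel (\<lambda>p. F p * (cmod (P p))\<^sup>2)"
    using complex_of_real_integrable_eq has_bochner_integral_iff by blast
  have s: "s = complex_of_real (LINT p|lborel. F p * (cmod (P p))\<^sup>2)"
    using h by (simp add: has_bochner_integral_iff del: of_real_mult)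
  have cP: "continuous_on UNIV P" unfolding P_def by (intro continuous_intros)
  show "Im s = 0" by (simp add: s)
  show "0 \<le> Re s" using nn by (simp add: s)
  fix k assume "s = 0" and k: "k < M"
  then have "(LINT p|lborel. F p * (cmod (P p))\<^sup>2) = 0" by (simp add: s)
  then have AE: "AE p in lborel. F p * (cmod (P p))\<^sup>2 = 0"
    using ih nn by (subst (asm) integral_nonneg_eq_0_iff_AE) auto
  \<comment> \<open>An open null set is empty, so the product vanishes everywhere and not merely
    almost everywhere.\<close>
  have op: "open {p. F p * (cmod (P p))\<^sup>2 \<noteq> 0}"
    by (intro open_Collect_neq continuous_intros c cP)
  have "{p. F p * (cmod (P p))\<^sup>2 \<noteq> 0} \<in> null_sets lborel"
    using AE op by (subst AE_iff_null_sets) (auto simp: borel_open)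
  then have "negligible {p. F p * (cmod (P p))\<^sup>2 \<noteq> 0}"
    by (simp add: negligible_iff_null_sets null_sets_completionI)
  then have "{p. F p * (cmod (P p))\<^sup>2 \<noteq> 0} = {}"
    using open_not_negligible[OF op] by blast
  then have FP: "F p * (cmod (P p))\<^sup>2 = 0" for p by blast
  have "open {p. 0 < F p}" by (intro open_Collect_less continuous_intros c)
  moreover have "p0 \<in> {p. 0 < F p}" using p0 by simp
  ultimately obtain r where r: "0 < r" "ball p0 r \<subseteq> {p. 0 < F p}"
    by (rule openE)
  have P0: "P p = 0" if "p \<in> ball p0 r" for p
    using FP[of p] r(2) that by auto
  \<comment> \<open>The vanishing lemma indexes coefficients by frequencies; injectivity of
    \<open>x\<close> allows the reindexing.\<close>
  have "d (the_inv_into {..<M} x (x k)) = 0"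
  proof (rule trig_poly_vanishing_on_ball[where S = "x ` {..<M}" and c = "\<lambda>z. d (the_inv_into {..<M} x z)" and r = r and ?p0.0 = p0])
    show "(\<Sum>z\<in>x ` {..<M}. d (the_inv_into {..<M} x z) * ?e z p) = 0" if "p \<in> ball p0 r" for p
      using P0[OF that] inj by (simp add: P_def sum.reindex the_inv_into_f_f)
  qed (use r k in auto)
  then show "d k = 0" using inj k by (simp add: the_inv_into_f_f)
qed

section \<open>Inverse Gram matrices and the bordered determinant\<close>

lemma cscalar_prod_sum:
  fixes v w :: "complex vec"
  assumes "v \<in> carrier_vec n" "w \<in> carrier_vec n"
  shows "v \<bullet>c w = (\<Sum>i<n. v $ i * cnj (w $ i))"
  using assms by (auto simp: scalar_prod_def conjugate_complex_def lessThan_atLeast0 intro!: sum.cong)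

lemma cscalar_prod_cnj:
  fixes v w :: "complex vec"
  assumes "v \<in> carrier_vec n" "w \<in> carrier_vec n"
  shows "cnj (v \<bullet>c w) = w \<bullet>c v"
  unfolding cscalar_prod_sum[OF assms] cscalar_prod_sum[OF assms(2,1)] by (simp add: mult.commute)

lemma mult_mat_vec_sum:
  fixes A :: "complex mat"
  assumes "A \<in> carrier_mat n n" "v \<in> carrier_vec n" "i < n"
  shows "(A *\<^sub>v v) $ i = (\<Sum>j<n. A $$ (i, j) * v $ j)"
  using assms by (auto simp: scalar_prod_def lessThan_atLeast0 intro!: sum.cong)

lemma mult_mat_sum:
  fixes A B :: "complex mat"
  assumes "A \<in> carrier_mat n n" "B \<in> carrier_mat n n" "i < n" "j < n"
  shows "(A * B) $$ (i, j) = (\<Sum>k<n. A $$ (i, k) * B $$ (k, j))"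
  using assms by (auto simp: scalar_prod_def lessThan_atLeast0 intro!: sum.cong)

text \<open>A definite matrix has trivial kernel, hence non-zero determinant. This guarantees that
  \<open>the (mat_inverse G)\<close> in \<open>Fc\<close> is a genuine inverse.\<close>

lemma pos_def_mat_inverse:
  assumes pd: "pos_def_mat G n"
  shows "\<exists>H. mat_inverse G = Some H \<and> H \<in> carrier_mat n n \<and> G * H = 1\<^sub>m n \<and> H * G = 1\<^sub>m n"
proof -
  have G: "G \<in> carrier_mat n n" using pd by (simp add: pos_def_mat_def)
  have "det G \<noteq> 0"
  proof
    assume "det G = 0"
    then obtain v where v: "v \<in> carrier_vec n" "v \<noteq> 0\<^sub>v n" "G *\<^sub>v v = 0\<^sub>v n"
      using det_0_iff_vec_prod_zero_field[OF G] by blast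
    then have "Re (0\<^sub>v n \<bullet>c v) > 0" using pd unfolding pos_def_mat_def by metis
    then show False using v(1) by (simp add: cscalar_prod_sum)
  qed
  then have "G \<in> Units (ring_mat TYPE(complex) n ())" by (rule det_non_zero_imp_unit[OF G])
  then obtain H where "mat_inverse G = Some H" using mat_inverse(1)[OF G, of "()"] by (cases "mat_inverse G") auto
  with mat_inverse(2)[OF G] show ?thesis by blast
qed

text \<open>With \<open>v = H *\<^sub>v u\<close> the form is the conjugate of the form of
  \<open>G\<close> at \<open>v\<close>, so the claim follows from positivity of
  \<open>G\<close>.\<close>

lemma pos_def_mat_inverse_form:
  assumes pd: "pos_def_mat G n" and H: "H \<in> carrier_mat n n" and GH: "G * H = 1\<^sub>m n"
    and u: "u \<in> carrier_vec n"
  shows "Im ((H *\<^sub>v u) \<bullet>c u) = 0" "0 \<le> Re ((H *\<^sub>v u) \<bullet>c u)"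
proof -
  have G: "G \<in> carrier_mat n n" using pd by (simp add: pos_def_mat_def)
  define v where "v = H *\<^sub>v u"
  have v: "v \<in> carrier_vec n" using H u by (simp add: v_def)
  have Gv: "G *\<^sub>v v = u"
    using GH G H u unfolding v_def by (metis assoc_mult_mat_vec one_mult_mat_vec)
  have eq: "v \<bullet>c u = cnj ((G *\<^sub>v v) \<bullet>c v)"
    unfolding Gv by (rule cscalar_prod_cnj[OF u v, symmetric])
  have "Im ((G *\<^sub>v v) \<bullet>c v) = 0 \<and> 0 \<le> Re ((G *\<^sub>v v) \<bullet>c v)"
  proof (cases "v = 0\<^sub>v n")
    case True
    have "(G *\<^sub>v v) \<bullet>c v = 0"
      unfolding Gv cscalar_prod_sum[OF u v] using True by simp
    then show ?thesis by simp
  next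
    case False
    then show ?thesis using pd v by (auto simp: pos_def_mat_def less_imp_le)
  qed
  then show "Im ((H *\<^sub>v u) \<bullet>c u) = 0" "0 \<le> Re ((H *\<^sub>v u) \<bullet>c u)"
    unfolding v_def[symmetric] eq by simp_all
qed

text \<open>Right multiplication by the unitriangular block matrix with off-diagonal block \<open>- H u\<close>
  clears the last column, leaving the Schur complement.\<close>

lemma det_bordered_mat:
  fixes G H :: "complex mat"
  assumes G: "G \<in> carrier_mat n n" and H: "H \<in> carrier_mat n n" and GH: "G * H = 1\<^sub>m n"
    and u: "u \<in> carrier_vec n"
    and A: "A \<in> carrier_mat (Suc n) (Suc n)"
    and AG: "\<And>i j. i < n \<Longrightarrow> j < n \<Longrightarrow> A $$ (i, j) = G $$ (i, j)"
    and Au: "\<And>i. i < n \<Longrightarrow> A $$ (i, n) = u $ i" "\<And>i. i < n \<Longrightarrow> A $$ (n, i) = cnj (u $ i)"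
    and A1: "A $$ (n, n) = 1"
  shows "det A = (1 - (H *\<^sub>v u) \<bullet>c u) * det G"
proof -
  define v where "v = H *\<^sub>v u"
  have v: "v \<in> carrier_vec n" using H u by (simp add: v_def)
  have Gv: "G *\<^sub>v v = u"
    using GH G H u unfolding v_def by (metis assoc_mult_mat_vec one_mult_mat_vec)
  define U where "U = mat n 1 (\<lambda>(i, j). u $ i)"
  define R where "R = mat 1 n (\<lambda>(i, j). cnj (u $ j))"
  define V where "V = mat n 1 (\<lambda>(i, j). - v $ i)"
  have carr: "U \<in> carrier_mat n 1" "R \<in> carrier_mat 1 n" "V \<in> carrier_mat n 1"
    by (auto simp: U_def R_def V_def)
  have Aeq: "A = four_block_mat G U R (1\<^sub>m 1)"
    using A G by (intro eq_matI) (auto simp: AG Au A1 U_def R_def less_Suc_eq)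
  let ?B = "four_block_mat (1\<^sub>m n) V (0\<^sub>m 1 n) (1\<^sub>m 1)"
  have "A * ?B = four_block_mat (G * 1\<^sub>m n + U * 0\<^sub>m 1 n) (G * V + U * 1\<^sub>m 1) (R * 1\<^sub>m n + 1\<^sub>m 1 * 0\<^sub>m 1 n) (R * V + 1\<^sub>m 1 * 1\<^sub>m 1)"
    unfolding Aeq by (rule mult_four_block_mat[OF G carr(1,2) one_carrier_mat one_carrier_mat carr(3) zero_carrier_mat one_carrier_mat])
  also have "G * 1\<^sub>m n + U * 0\<^sub>m 1 n = G" using G right_mult_zero_mat[OF carr(1)] by simp
  also have "R * 1\<^sub>m n + 1\<^sub>m 1 * 0\<^sub>m 1 n = R" using right_mult_one_mat[OF carr(2)] carr(2) by simp
  \<comment> \<open>Here \<open>G * V\<close> is the column \<open>- G v = - u\<close>, which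
    cancels \<open>U\<close>.\<close>
  also have "G * V + U * 1\<^sub>m 1 = 0\<^sub>m n 1"
  proof (rule eq_matI)
    fix i j assume "i < dim_row (0\<^sub>m n 1 :: complex mat)" "j < dim_col (0\<^sub>m n 1 :: complex mat)"
    then have ij: "i < n" "j = 0" by auto
    have "(G * V) $$ (i, 0) = - (\<Sum>k<n. G $$ (i, k) * v $ k)"
      using G v ij by (auto simp: V_def scalar_prod_def lessThan_atLeast0 sum_negf[symmetric] intro!: sum.cong)
    also have "\<dots> = - (G *\<^sub>v v) $ i" using mult_mat_vec_sum[OF G v ij(1)] by simp
    finally have "(G * V) $$ (i, 0) = - u $ i" by (simp add: Gv)
    then show "(G * V + U * 1\<^sub>m 1) $$ (i, j) = 0\<^sub>m n 1 $$ (i, j)"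
      using G ij right_mult_one_mat[OF carr(1)] by (simp add: V_def) (simp add: U_def)
  qed (use G in \<open>auto simp: U_def V_def\<close>)
  finally have AB: "A * ?B = four_block_mat G (0\<^sub>m n 1) R (R * V + 1\<^sub>m 1 * 1\<^sub>m 1)" .
  have "(R * V) $$ (0, 0) = - (\<Sum>k<n. v $ k * cnj (u $ k))"
    by (auto simp: V_def R_def scalar_prod_def lessThan_atLeast0 sum_negf[symmetric] intro!: sum.cong)
  then have RV: "(R * V + 1\<^sub>m 1 * 1\<^sub>m 1) $$ (0, 0) = 1 - v \<bullet>c u"
    unfolding cscalar_prod_sum[OF v u] by (simp add: R_def V_def)
  have "det A * det ?B = det (A * ?B)"
    by (rule det_mult[OF A, symmetric]) (use four_block_carrier_mat[of "1\<^sub>m n" n n "1\<^sub>m 1" 1 1] in auto)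
  also have "\<dots> = det G * det (R * V + 1\<^sub>m 1 * 1\<^sub>m 1)"
    unfolding AB by (rule det_four_block_mat_upper_right_zero[OF G]) (auto simp: R_def V_def)
  also have "det (R * V + 1\<^sub>m 1 * 1\<^sub>m 1) = 1 - v \<bullet>c u"
    using RV by (subst det_single) (auto simp: R_def V_def)
  also have "det ?B = 1"
    by (subst det_four_block_mat_lower_left_zero[OF one_carrier_mat carr(3) refl one_carrier_mat]) simp
  finally show ?thesis by (simp add: v_def)
qed

section \<open>Distance from a function to the span of a finite family\<close>

lemma L2_inner_add:
  assumes "sq_integrable lborel f" "sq_integrable lborel h" "sq_integrable lborel k"
  shows "L2_inner (\<lambda>t. f t + h t) k = L2_inner f k + L2_inner h k"
  using sq_integrable_mult_cnj_integrable[OF assms(1,3)] sq_integrable_mult_cnj_integrable[OF assms(2,3)]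
  by (simp add: L2_inner_def distrib_right)

lemma L2_inner_cmult: "L2_inner (\<lambda>t. c * f t) k = c * L2_inner f k"
  by (simp add: L2_inner_def mult.assoc)

lemma L2_inner_sum:
  fixes n :: nat
  assumes "\<And>i. i < n \<Longrightarrow> sq_integrable lborel (f i)" "sq_integrable lborel k"
  shows "L2_inner (\<lambda>t. \<Sum>i<n. c i * f i t) k = (\<Sum>i<n. c i * L2_inner (f i) k)"
proof -
  have "integrable lborel (\<lambda>t. c i * (f i t * cnj (k t)))" if "i < n" for i
    by (intro integrable_mult_right sq_integrable_mult_cnj_integrable assms that)
  then show ?thesis
    by (simp add: L2_inner_def sum_distrib_right mult.assoc)
qed

lemma L2_inner_self: "L2_inner f f = complex_of_real (LINT t|lborel. (cmod (f t))\<^sup>2)"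
  by (simp add: L2_inner_def flip: integral_complex_of_real complex_norm_square)

text \<open>One minus the form is the squared distance from \<open>h\<close> to the span of the \<open>f i\<close>, which is
  attained at \<open>\<Sum>i. cnj ((H u)\<^sub>i) f\<^sub>i\<close>.\<close>

lemma gramian_inverse_form_le_1:
  assumes f: "\<And>i. i < n \<Longrightarrow> sq_integrable lborel (f i)" and h: "sq_integrable lborel h"
    and h1: "L2_inner h h = 1"
    and pd: "pos_def_mat (gramian f n) n" and H: "H \<in> carrier_mat n n" and GH: "gramian f n * H = 1\<^sub>m n"
    and u: "u = vec n (\<lambda>i. L2_inner (f i) h)"
  shows "Re ((H *\<^sub>v u) \<bullet>c u) \<le> 1"
proof -
  let ?G = "gramian f n"
  have G: "?G \<in> carrier_mat n n" by (simp add: gramian_def)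
  have uc: "u \<in> carrier_vec n" by (simp add: u)
  define v where "v = H *\<^sub>v u"
  have v: "v \<in> carrier_vec n" using H uc by (simp add: v_def)
  have Gv: "?G *\<^sub>v v = u"
    using GH G H uc unfolding v_def by (metis assoc_mult_mat_vec one_mult_mat_vec)
  \<comment> \<open>The conjugates are undone by conjugate linearity in the second argument:
    \<open>L2_inner (f i) w\<close> is then the entry \<open>i\<close> of
    \<open>?G *\<^sub>v v = u\<close>, so \<open>h - w\<close> is orthogonal to every
    \<open>f i\<close>.\<close>
  define w where "w t = (\<Sum>i<n. cnj (v $ i) * f i t)" for t
  have w: "sq_integrable lborel w"
    unfolding w_def[abs_def] by (intro sq_integrable_sum sq_integrable_cmult f) simp
  have real: "cnj (v \<bullet>c u) = v \<bullet>c u"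
    using pos_def_mat_inverse_form(1)[OF pd H GH uc] by (simp add: v_def complex_eq_iff)
  have uv: "(\<Sum>i<n. cnj (v $ i) * u $ i) = v \<bullet>c u"
    by (subst real[symmetric], subst cscalar_prod_sum[OF v uc]) simp
  have w_inner: "L2_inner w k = (\<Sum>i<n. cnj (v $ i) * L2_inner (f i) k)" if "sq_integrable lborel k" for k
    unfolding w_def[abs_def] by (rule L2_inner_sum[OF f that])
  have wh: "L2_inner w h = v \<bullet>c u"
    unfolding w_inner[OF h] uv[symmetric] by (intro sum.cong) (auto simp: u)
  have hw: "L2_inner h w = v \<bullet>c u"
    using L2_inner_cnj[of w h] unfolding wh real by simp
  have fw: "L2_inner (f i) w = u $ i" if i: "i < n" for i
  proof -
    have "L2_inner (f i) w = cnj (L2_inner w (f i))" by (simp add: L2_inner_cnj)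
    also have "\<dots> = (\<Sum>j<n. v $ j * cnj (L2_inner (f j) (f i)))"
      unfolding w_inner[OF f[OF i]] by simp
    also have "\<dots> = (\<Sum>j<n. ?G $$ (i, j) * v $ j)"
      unfolding L2_inner_cnj using i by (intro sum.cong) (auto simp: gramian_def)
    also have "\<dots> = u $ i" using mult_mat_vec_sum[OF G v i] by (simp add: Gv)
    finally show ?thesis .
  qed
  have ww: "L2_inner w w = v \<bullet>c u"
    unfolding w_inner[OF w] uv[symmetric] by (intro sum.cong) (auto simp: fw)
  have m: "sq_integrable lborel (\<lambda>t. - 1 * w t)" by (rule sq_integrable_cmult[OF w])
  define d where "d t = h t + - 1 * w t" for t
  have d: "sq_integrable lborel d" unfolding d_def[abs_def] by (rule sq_integrable_add[OF h m])
  have dk: "L2_inner d k = L2_inner h k - L2_inner w k" if "sq_integrable lborel k" for k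
    unfolding d_def[abs_def] L2_inner_add[OF h m that] L2_inner_cmult by simp
  have kd: "L2_inner k d = L2_inner k h - L2_inner k w" if "sq_integrable lborel k" for k
    using arg_cong[OF dk[OF that], of cnj] by (simp add: L2_inner_cnj)
  \<comment> \<open>The products of \<open>w\<close> with \<open>h\<close>, in either order, and of
    \<open>w\<close> with itself all equal \<open>v \<bullet>c u\<close>, so two of the four terms
    cancel.\<close>
  have "L2_inner d d = 1 - v \<bullet>c u"
    by (simp add: dk[OF d] kd[OF h] kd[OF w] h1 wh hw ww)
  then have "Re (1 - v \<bullet>c u) = (LINT t|lborel. (cmod (d t))\<^sup>2)"
    by (metis L2_inner_self Re_complex_of_real)
  also have "\<dots> \<ge> 0" by simp
  finally show ?thesis by (simp add: v_def)
qed

text \<open>Translating the variable by \<open>a\<close> produces exactly the phase in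
  \<open>uvec\<close>, so its entries are inner products of the system with the shift of
  \<open>g\<close> at \<open>p\<close>.\<close>

lemma stft_tf_shift:
  "stft g (tf_shift a b g) p = chr (a * (snd p - b)) * stft g g (fst p - a, snd p - b)"
proof -
  let ?k = "\<lambda>t. chr (a * (snd p - b)) * (g t * cnj (g (t - (fst p - a))) * chr ((snd p - b) * t))"
  have "stft g (tf_shift a b g) p = (LINT t|lborel. ?k (t - a))"
    unfolding stft_eq_ft ft_def
  proof (intro Bochner_Integration.integral_cong refl)
    fix t
    have "chr (- (b * t)) * chr (snd p * t) = chr (a * (snd p - b)) * chr ((snd p - b) * (t - a))"
      unfolding chr_add[symmetric] by (simp add: algebra_simps)
    then show "tf_shift a b g t * cnj (g (t - fst p)) * chr (snd p * t) = ?k (t - a)"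
      by (simp add: tf_shift_chr algebra_simps)
  qed
  also have "\<dots> = (LINT t|lborel. ?k t)" by (rule integral_translate)
  finally show ?thesis by (simp add: stft_eq_ft ft_def)
qed

lemma inner_tf_shift_rotated:
  "L2_inner (tf_shift (snd q) (- fst q) f) h = cnj (stft f h (snd q, - fst q))"
  by (simp add: stft_eq_inner L2_inner_cnj)

section \<open>Bounds, continuity, integral, Fourier transform and determinant formula for
  \<open>F\<close>\<close>

theorem theorem3p1:
  fixes g :: "real \<Rightarrow> complex" and a b :: "nat \<Rightarrow> real" and N :: nat
  assumes g_meas: "g \<in> borel_measurable lborel"
    and g_L2: "integrable lborel (\<lambda>t. (cmod (g t))\<^sup>2)"
    and g_norm: "(LINT t|lborel. (cmod (g t))\<^sup>2) = 1"
    and N_pos: "0 < N"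
    and distinct: "inj_on (\<lambda>k. (a k, b k)) {..<N}"
    and first: "a 0 = 0" "b 0 = 0"
    and posdef: "pos_def_mat (GN g a b N) N"
  defines "F \<equiv> (\<lambda>p. Re (Fc g a b N p))"
  shows "((\<forall>p. Im (Fc g a b N p) = 0 \<and> 0 \<le> F p \<and> F p \<le> 1) \<and> (\<forall>k<N. F (a k, b k) = 1)) \<and>
         (uniformly_continuous_on UNIV F \<and> (F \<longlongrightarrow> 0) at_infinity) \<and>
         has_bochner_integral lborel F (real N) \<and>
         (strictly_pos_def (fourier2 (\<lambda>p. complex_of_real (F p))) \<and>
         integrable lborel (fourier2 (\<lambda>p. complex_of_real (F p)))) \<and>
         (\<forall>p. det (GN1 g a b N p) = complex_of_real (1 - F p) * det (GN g a b N))"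
proof -
  have g: "sq_integrable lborel g" using g_meas g_L2 by (simp add: sq_integrable_def)
  define f where "f = sys g a b"
  have f: "sq_integrable lborel (f k)" for k
    by (simp add: f_def sys_def sq_integrable_tf_shift g)
  have inner_shift: "L2_inner (tf_shift x y g) (tf_shift x y g) = 1" for x y
  proof -
    have "(LINT t|lborel. (cmod (tf_shift x y g t))\<^sup>2) = (norm_L2 lborel (tf_shift x y g))\<^sup>2"
      by (simp add: norm_L2_sq)
    also have "\<dots> = 1" unfolding norm_L2_tf_shift norm_L2_sq by (rule g_norm)
    finally show ?thesis by (simp add: L2_inner_self)
  qed
  have gg: "L2_inner g g = 1" by (simp add: L2_inner_self g_norm)
  define G where "G = GN g a b N"
  have Gdef: "G = gramian f N" by (simp add: G_def GN_def f_def)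
  have G: "G \<in> carrier_mat N N" and Gkl: "\<And>k l. k < N \<Longrightarrow> l < N \<Longrightarrow> G $$ (k, l) = L2_inner (f k) (f l)"
    by (auto simp: Gdef gramian_def)
  note pd = posdef[folded G_def]
  obtain H where inv: "mat_inverse G = Some H" and H: "H \<in> carrier_mat N N"
    and GH: "G * H = 1\<^sub>m N" and HG: "H * G = 1\<^sub>m N"
    using pos_def_mat_inverse[OF pd] by blast
  define u where "u = uvec g a b N"
  have uc: "u p \<in> carrier_vec N" for p by (simp add: u_def uvec_def)
  have uk: "u p $ k = stft g (f k) p" if "k < N" for p k
    using that stft_tf_shift[of g "a k" "b k" p] by (simp add: u_def uvec_def f_def sys_def chr_def)
  have uvec_eq: "u p = vec N (\<lambda>k. L2_inner (f k) (tf_shift (fst p) (snd p) g))" for p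
    using uc[of p] by (intro eq_vecI) (auto simp: uk stft_eq_inner)
  have Fc: "Fc g a b N p = (H *\<^sub>v u p) \<bullet>c u p" for p
    using inv by (simp add: Fc_def G_def u_def)
  \<comment> \<open>In this form uniform continuity, the orthogonality relations and the character
    rule can be applied term by term.\<close>
  have Fc_sum: "Fc g a b N p = (\<Sum>j<N. \<Sum>k<N. H $$ (j, k) * (stft g (f k) p * cnj (stft g (f j) p)))" for p
  proof -
    have Hu: "H *\<^sub>v u p \<in> carrier_vec N" using H uc by simp
    show ?thesis
      unfolding Fc cscalar_prod_sum[OF Hu uc]
      using mult_mat_vec_sum[OF H uc, of _ p] by (simp add: uk sum_distrib_right mult.assoc)
  qed
  have ImF: "Im (Fc g a b N p) = 0" and F0: "0 \<le> F p" for p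
    using pos_def_mat_inverse_form[OF pd H GH uc] by (simp_all add: Fc F_def)
  have FcF: "Fc g a b N p = complex_of_real (F p)" for p
    using ImF by (simp add: F_def complex_eq_iff)
  have F1: "F p \<le> 1" for p
    unfolding F_def Fc
    by (rule gramian_inverse_form_le_1[where f = f and h = "tf_shift (fst p) (snd p) g"])
      (use pd H GH uvec_eq in \<open>auto simp: f sq_integrable_tf_shift g inner_shift Gdef\<close>)
  \<comment> \<open>At a node \<open>u\<close> is the column \<open>k\<close> of \<open>G\<close>,
    so \<open>H\<close> maps it to a unit vector and the form picks out the norm of
    \<open>f k\<close>.\<close>
  have Fk: "F (a k, b k) = 1" if k: "k < N" for k
  proof -
    have "u (a k, b k) = col G k"
      using k G by (intro eq_vecI) (auto simp: uvec_eq Gkl f_def sys_def)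
    then have "H *\<^sub>v u (a k, b k) = unit_vec N k"
      using col_mult2[OF H G k] HG k by simp
    moreover have "(unit_vec N k :: complex vec) \<bullet>c u (a k, b k) = 1"
      using k unfolding cscalar_prod_sum[OF unit_vec_carrier uc]
      by (simp add: unit_vec_def uvec_eq f_def sys_def inner_shift if_distrib[of "\<lambda>x. x * _"] cong: if_cong)
    ultimately show ?thesis by (simp add: F_def Fc)
  qed
  have ucF: "uniformly_continuous_on UNIV F"
    unfolding F_def Fc_sum
    by (intro bounded_linear.uniformly_continuous_on[OF bounded_linear_Re]
        uniformly_continuous_on_sum uniformly_continuous_on_cmul_left uniformly_continuous_stft_product f g)
  have "has_bochner_integral lborel (Fc g a b N) (\<Sum>j<N. \<Sum>k<N. H $$ (j, k) * (L2_inner (f k) (f j) * cnj (L2_inner g g)))"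
    unfolding Fc_sum[abs_def]
    by (intro has_bochner_integral_sum has_bochner_integral_mult_right stft_orthogonality f g)
  \<comment> \<open>Since the window has norm \<open>1\<close>, the sum is the trace of
    \<open>H * G\<close>, the identity of size \<open>N\<close>.\<close>
  also have "(\<Sum>j<N. \<Sum>k<N. H $$ (j, k) * (L2_inner (f k) (f j) * cnj (L2_inner g g))) = (\<Sum>j<N. (H * G) $$ (j, j))"
    using mult_mat_sum[OF H G] by (simp add: gg Gkl)
  also have "\<dots> = complex_of_real (real N)"
    by (simp add: HG)
  finally have bF: "has_bochner_integral lborel F (real N)"
    unfolding F_def using has_bochner_integral_bounded_linear[OF bounded_linear_Re] by fastforce
  have iF: "integrable lborel F" using bF by (simp add: has_bochner_integral_iff)
  have lim: "(F \<longlongrightarrow> 0) at_infinity"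
    by (rule uniformly_continuous_integrable_tendsto_0[OF ucF iF F0])
  have spd: "strictly_pos_def (fourier2 (\<lambda>p. complex_of_real (F p)))"
    by (rule strictly_pos_def_fourier2[OF iF F0 uniformly_continuous_imp_continuous[OF ucF], of "(a 0, b 0)"])
      (use Fk[OF N_pos] in simp)
  \<comment> \<open>The character is absorbed by shifting only the unconjugated factor, so
    orthogonality pairs shifted with unshifted functions. The resulting inner products are
    short-time Fourier transforms at the rotated point.\<close>
  have fF: "fourier2 (\<lambda>p. complex_of_real (F p)) q
      = (\<Sum>j<N. \<Sum>k<N. H $$ (j, k) * (stft g g (snd q, - fst q) * cnj (stft (f k) (f j) (snd q, - fst q))))" for q
  proof -
    let ?\<pi> = "tf_shift (snd q) (- fst q)"
    have shift: "stft (?\<pi> g) (?\<pi> h) p = chr (fst p * fst q + snd p * snd q) * stft g h p" for h p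
      using stft_chr[of "fst p" "fst q" "snd p" "snd q" g h] by simp
    have e: "complex_of_real (F p) * chr (fst p * fst q + snd p * snd q)
      = (\<Sum>j<N. \<Sum>k<N. H $$ (j, k) * (stft (?\<pi> g) (?\<pi> (f k)) p * cnj (stft g (f j) p)))" for p
      unfolding FcF[symmetric] Fc_sum sum_distrib_right
      by (intro sum.cong refl) (simp add: shift)
    have "has_bochner_integral lborel (\<lambda>p. complex_of_real (F p) * chr (fst p * fst q + snd p * snd q))
      (\<Sum>j<N. \<Sum>k<N. H $$ (j, k) * (L2_inner (?\<pi> (f k)) (f j) * cnj (L2_inner (?\<pi> g) g)))"
      unfolding e
      by (intro has_bochner_integral_sum has_bochner_integral_mult_right stft_orthogonality sq_integrable_tf_shift f g)
    then show ?thesis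
      by (simp add: fourier2_chr has_bochner_integral_iff inner_tf_shift_rotated mult.commute)
  qed
  have ifF: "integrable lborel (fourier2 (\<lambda>p. complex_of_real (F p)))"
    unfolding fF[abs_def]
    by (intro Bochner_Integration.integrable_sum integrable_mult_right integrable_stft_rotated f g)
  have "det (GN1 g a b N p) = complex_of_real (1 - F p) * det G" for p
  proof -
    let ?h = "tf_shift (fst p) (snd p) g"
    have "det (GN1 g a b N p) = (1 - (H *\<^sub>v u p) \<bullet>c u p) * det G"
      by (rule det_bordered_mat[OF G H GH uc])
        (auto simp: GN1_def gramian_def Gkl uvec_eq L2_inner_cnj inner_shift simp flip: f_def)
    also have "(H *\<^sub>v u p) \<bullet>c u p = complex_of_real (F p)"
      using FcF[of p] by (simp add: Fc)
    finally show ?thesis by simp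
  qed
  then show ?thesis
    using ImF F0 F1 Fk ucF lim bF spd ifF by (simp add: G_def)
qed

end
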